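(* There exists a constant $C$ independent of $h$ and $z$ such that for all $0<h<1$ and all $z\in\Omega_h$, $$\|\nabla G_h^z\|_{L^2(\Omega_h)}\le \|\nabla\widetilde{G}^z\|_{L^2(\Omega_h)}\le C h^{-1/2}.$$
   Context: Let $\Omega\subset\mathbb{R}^3$ be a convex bounded domain with sufficiently smooth boundary. Let $\{\mathcal{T}_h\}_{0<h<1}$ be a quasi-uniform, shape-regular family of triangulations (by tetrahedra) of size $h$ of polyhedral computational domains $\Omega_h\subset\Omega$. Let $V_h(\Omega_h)$ be the space of continuous functions on $\Omega_h$ that are affine on each tetrahedron of $\mathcal{T}_h$, and let $V_h^0(\Omega_h)\subset V_h(\Omega_h)$ be the subspace of functions vanishing on $\partial\Omega_h$ (extended by zero to $\Omega$ where needed). Write $(u,v)_\Omega=\int_\Omega u\cdot v\,dx$. The discrete Green's function with singularity at $z\in\Omega_h$ is the unique $G_h^z\in V_h^0(\Omega_h)$ satisfying $(\nabla G_h^z,\nabla v_h)_\Omega=v_h(z)$ for all $v_h\in V_h^0(\Omega_h)$. For $z\in\Omega_h$, let $\tilde\delta^z\ge 0$ be a regularized delta function: a function supported in an element $\tau_0\in\mathcal{T}_h$ containing $z$ with $\int_{\tau_0}\tilde\delta^z v_h\,dx=v_h(z)$ for all $v_h\in V_h(\Omega_h)$ (in particular $\int_{\tau_0}\tilde\delta^z\,dx=1$), and satisfying, with a constant $C$ independent of $z$ and $h$, $\|\tilde\delta^z\|_{W^s_p(\tau_0)}\le C h^{-s-3(1-1/p)}$ for $1\le p\le\infty$, $s=0,1$.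 The regularized Green's function $\widetilde{G}^z$ is the solution of $-\Delta\widetilde{G}^z=\tilde\delta^z$ in $\Omega$, $\widetilde{G}^z=0$ on $\partial\Omega$. *)

theory Defs
  imports "HOL-Analysis.Analysis" "HOL-Probability.Essential_Supremum"
begin

section \<open>Smooth functions and smooth boundaries\<close>

abbreviation partial :: "('a::euclidean_space \<Rightarrow> real) \<Rightarrow> 'a \<Rightarrow> 'a \<Rightarrow> real" where
  "partial f b \<equiv> (\<lambda>x. frechet_derivative f (at x) b)"

primrec Ck :: "nat \<Rightarrow> ('a::euclidean_space \<Rightarrow> real) \<Rightarrow> bool" where
  "Ck 0 f = continuous_on UNIV f"
| "Ck (Suc k) f = (f differentiable_on UNIV \<and> (\<forall>b\<in>Basis. Ck k (partial f b)))"

text \<open>After an orthogonal change of coordinates, \<open>\<Omega>\<close> is locally the region above the graph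
  of a \<open>C\<^sup>k\<close> function.\<close>

definition Ck_boundary :: "nat \<Rightarrow> (real^3) set \<Rightarrow> bool" where
  "Ck_boundary k \<Omega> \<longleftrightarrow>
     (\<forall>x0\<in>frontier \<Omega>. \<exists>r>0. \<exists>R::real^3 \<Rightarrow> real^3. \<exists>\<gamma>::real^2 \<Rightarrow> real.
        orthogonal_transformation R \<and> Ck k \<gamma> \<and>
        \<Omega> \<inter> ball x0 r = {x \<in> ball x0 r. R x $ 3 > \<gamma> (vector [R x $ 1, R x $ 2])})"


section \<open>Lebesgue and Sobolev spaces\<close>

definition Lp :: "ereal \<Rightarrow> (real^3) set \<Rightarrow> (real^3 \<Rightarrow> 'b::euclidean_space) set" where
  "Lp p U = {f. f \<in> borel_measurable (lebesgue_on U) \<and>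
     (if p = \<infinity> then esssup (lebesgue_on U) (\<lambda>x. ereal (norm (f x))) < \<infinity>
      else integrable (lebesgue_on U) (\<lambda>x. norm (f x) powr real_of_ereal p))}"

definition Lp_norm :: "ereal \<Rightarrow> (real^3) set \<Rightarrow> (real^3 \<Rightarrow> 'b::euclidean_space) \<Rightarrow> real" where
  "Lp_norm p U f =
     (if p = \<infinity> then real_of_ereal (esssup (lebesgue_on U) (\<lambda>x. ereal (norm (f x))))
      else (LINT x|lebesgue_on U. norm (f x) powr real_of_ereal p) powr (1 / real_of_ereal p))"

definition test_functions :: "(real^3) set \<Rightarrow> (real^3 \<Rightarrow> real) set" where
  "test_functions U = {\<phi>. (\<forall>k. Ck k \<phi>) \<and> compact (closure {x. \<phi> x \<noteq> 0}) \<and>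
     closure {x. \<phi> x \<noteq> 0} \<subseteq> U}"

definition has_weak_gradient ::
    "(real^3) set \<Rightarrow> (real^3 \<Rightarrow> real) \<Rightarrow> (real^3 \<Rightarrow> real^3) \<Rightarrow> bool" where
  "has_weak_gradient U u p \<longleftrightarrow>
     (\<forall>K. compact K \<and> K \<subseteq> U \<longrightarrow> u absolutely_integrable_on K \<and> p absolutely_integrable_on K) \<and>
     (\<forall>\<phi>\<in>test_functions U. \<forall>i.
        (LINT x|lebesgue_on U. u x * partial \<phi> (axis i 1) x) =
        - (LINT x|lebesgue_on U. p x $ i * \<phi> x))"

text \<open>The weak gradient is determined almost everywhere on \<open>U\<close>; the choice below picks a
  representative, and is only used for functions that have a weak gradient.\<close>

definition weak_gradient :: "(real^3) set \<Rightarrow> (real^3 \<Rightarrow> real) \<Rightarrow> real^3 \<Rightarrow> real^3" where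
  "weak_gradient U u = (SOME p. has_weak_gradient U u p)"

definition W1 :: "ereal \<Rightarrow> (real^3) set \<Rightarrow> (real^3 \<Rightarrow> real) set" where
  "W1 p U = {u \<in> Lp p U. (\<exists>q. has_weak_gradient U u q) \<and> weak_gradient U u \<in> Lp p U}"

definition W1_norm :: "ereal \<Rightarrow> (real^3) set \<Rightarrow> (real^3 \<Rightarrow> real) \<Rightarrow> real" where
  "W1_norm p U u =
     (if p = \<infinity>
      then max (Lp_norm p U u) (MAX i. Lp_norm p U (\<lambda>x. weak_gradient U u x $ i))
      else (Lp_norm p U u powr real_of_ereal p
            + (\<Sum>i\<in>UNIV. Lp_norm p U (\<lambda>x. weak_gradient U u x $ i) powr real_of_ereal p))
           powr (1 / real_of_ereal p))"

definition H10 :: "(real^3) set \<Rightarrow> (real^3 \<Rightarrow> real) set" where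
  "H10 U = {u \<in> W1 2 U. \<exists>\<phi>. (\<forall>n. \<phi> n \<in> test_functions U) \<and>
     (\<lambda>n::nat. W1_norm 2 U (\<lambda>x. \<phi> n x - u x)) \<longlonglongrightarrow> 0}"

definition grad_form :: "(real^3) set \<Rightarrow> (real^3 \<Rightarrow> real) \<Rightarrow> (real^3 \<Rightarrow> real) \<Rightarrow> real" where
  "grad_form U u v = (LINT x|lebesgue_on U. weak_gradient U u x \<bullet> weak_gradient U v x)"

text \<open>Weak solution of \<open>-\<Delta>u = f\<close> in \<open>U\<close>, \<open>u = 0\<close> on the boundary.\<close>

definition dirichlet_solution ::
    "(real^3) set \<Rightarrow> (real^3 \<Rightarrow> real) \<Rightarrow> (real^3 \<Rightarrow> real) \<Rightarrow> bool" where
  "dirichlet_solution U f u \<longleftrightarrow>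
     u \<in> H10 U \<and> (\<forall>v\<in>H10 U. grad_form U u v = (LINT x|lebesgue_on U. f x * v x))"


section \<open>Families of triangulations\<close>

text \<open>The elements are closed tetrahedra; the computational domain is open, so that
  \<open>mesh_domain \<T> \<subseteq> \<Omega>\<close> allows boundary vertices of the mesh to lie on the
  boundary of \<open>\<Omega>\<close>.\<close>

definition mesh_domain :: "(real^3) set set \<Rightarrow> (real^3) set" where
  "mesh_domain \<T> = interior (\<Union>\<T>)"

definition tetrahedral_mesh :: "(real^3) set set \<Rightarrow> bool" where
  "tetrahedral_mesh \<T> \<longleftrightarrow>
     \<T> \<noteq> {} \<and> triangulation \<T> \<and> (\<forall>\<tau>\<in>\<T>. 3 simplex \<tau>) \<and> connected (mesh_domain \<T>)"

text \<open>Size \<open>h\<close> is read as \<open>diam \<tau> \<le> h\<close>; the matching lower bound up to a constant is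
  quasi-uniformity. (Requiring that the maximal diameter equals \<open>h\<close> for every \<open>h\<close> up to 1
  would be impossible in a domain of small diameter.)\<close>

definition mesh_family :: "(real^3) set \<Rightarrow> (real \<Rightarrow> (real^3) set set) \<Rightarrow> bool" where
  "mesh_family \<Omega> \<T> \<longleftrightarrow>
     (\<forall>h\<in>{0<..<1}. tetrahedral_mesh (\<T> h) \<and> mesh_domain (\<T> h) \<subseteq> \<Omega> \<and>
        (\<forall>\<tau>\<in>\<T> h. diameter \<tau> \<le> h))"

definition quasi_uniform :: "(real \<Rightarrow> (real^3) set set) \<Rightarrow> bool" where
  "quasi_uniform \<T> \<longleftrightarrow> (\<exists>c>0. \<forall>h\<in>{0<..<1}. \<forall>\<tau>\<in>\<T> h. c * h \<le> diameter \<tau>)"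

definition shape_regular :: "(real \<Rightarrow> (real^3) set set) \<Rightarrow> bool" where
  "shape_regular \<T> \<longleftrightarrow>
     (\<exists>c>0. \<forall>h\<in>{0<..<1}. \<forall>\<tau>\<in>\<T> h. \<exists>x. cball x (c * diameter \<tau>) \<subseteq> \<tau>)"


section \<open>Finite element space and Green's functions\<close>

definition P1_space :: "(real^3) set set \<Rightarrow> (real^3 \<Rightarrow> real) set" where
  "P1_space \<T> = {v. continuous_on (\<Union>\<T>) v \<and>
     (\<forall>\<tau>\<in>\<T>. \<exists>a b. \<forall>x\<in>\<tau>. v x = a \<bullet> x + b)}"

text \<open>Vanishing outside the open set \<open>mesh_domain \<T>\<close> comprises both the boundary
  condition on its frontier and the extension by zero.\<close>

definition P1_space0 :: "(real^3) set set \<Rightarrow> (real^3 \<Rightarrow> real) set" where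
  "P1_space0 \<T> = {v \<in> P1_space \<T>. \<forall>x. x \<notin> mesh_domain \<T> \<longrightarrow> v x = 0}"

definition discrete_green ::
    "(real^3) set \<Rightarrow> (real^3) set set \<Rightarrow> real^3 \<Rightarrow> (real^3 \<Rightarrow> real) \<Rightarrow> bool" where
  "discrete_green \<Omega> \<T> z g \<longleftrightarrow>
     g \<in> P1_space0 \<T> \<and> (\<forall>v\<in>P1_space0 \<T>. grad_form \<Omega> g v = v z)"

text \<open>No sign is imposed on \<open>\<delta>\<close>. If \<open>z\<close> lies on a face of \<open>\<tau>0\<close>, a nonnegative \<open>\<delta>\<close>
  cannot satisfy the moment conditions: the barycentric coordinate vanishing on that face
  would have zero integral against \<open>\<delta>\<close>, forcing \<open>\<delta> = 0\<close> almost everywhere. Hence a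
  nonnegative \<open>\<delta>\<close> cannot exist for all \<open>z\<close>.

  In the exponents, \<open>1 / p\<close> is taken in the extended reals, so that it is \<open>0\<close> for
  \<open>p = \<infinity>\<close>.\<close>

definition regularized_delta ::
    "(real^3) set set \<Rightarrow> real \<Rightarrow> real \<Rightarrow> real^3 \<Rightarrow> (real^3 \<Rightarrow> real) \<Rightarrow> bool" where
  "regularized_delta \<T> h K z \<delta> \<longleftrightarrow>
     (\<exists>\<tau>0\<in>\<T>. z \<in> \<tau>0 \<and> (\<forall>x. x \<notin> \<tau>0 \<longrightarrow> \<delta> x = 0) \<and>
        (\<forall>v\<in>P1_space \<T>. (LINT x|lebesgue_on \<tau>0. \<delta> x * v x) = v z) \<and>
        (\<forall>p::ereal. 1 \<le> p \<longrightarrow>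
           \<delta> \<in> W1 p (interior \<tau>0) \<and>
           Lp_norm p (interior \<tau>0) \<delta> \<le> K * h powr (- 3 * (1 - real_of_ereal (1 / p))) \<and>
           W1_norm p (interior \<tau>0) \<delta> \<le> K * h powr (- 1 - 3 * (1 - real_of_ereal (1 / p)))))"

end

theory Submission
  imports Defs
begin

text \<open>
  Both estimates are energy arguments for the weak form of the two problems.

  \<^item> The first inequality is a Galerkin argument. Discrete functions vanishing on the boundary of
    the mesh belong to \<open>H10 \<Omega>\<close> (\<open>P1_space0_H10\<close>), so \<open>Gh\<close> is an admissible test function
    in both equations. Since \<open>\<delta>\<close> reproduces point values of piecewise affine functions, this gives
    \<open>(\<nabla>Gt, \<nabla>Gh) = Gh(z) = (\<nabla>Gh, \<nabla>Gh)\<close>. The gradient of \<open>Gh\<close> vanishes outside the mesh,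
    hence only the gradient of \<open>Gt\<close> on the mesh enters, and Young's inequality
    \<open>2ab \<le> a\<^sup>2 + b\<^sup>2\<close> finishes the proof (\<open>galerkin_gradient_bound\<close>).

  \<^item> For the second inequality, test the equation of \<open>Gt\<close> with \<open>Gt\<close> itself. This gives
    \<open>(\<nabla>Gt, \<nabla>Gt) = \<integral> \<delta> Gt\<close>, an integral over one element \<open>\<tau>\<close>, which lies in the ball of radius
    \<open>h\<close> about \<open>z\<close>. As the \<open>L\<^sup>2\<close> norm of \<open>\<delta>\<close> is at most of order \<open>h\<^sup>-\<^sup>3\<^sup>/\<^sup>2\<close>, it suffices that
    the \<open>L\<^sup>2\<close> norm of \<open>Gt\<close> on \<open>\<tau>\<close> is at most of order \<open>h\<close> times the energy norm of
    \<open>Gt\<close>. In place of the Sobolev embedding of \<open>H\<^sup>1\<close> into \<open>L\<^sup>6\<close>, this is obtained from Hardy's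
    inequality, regularized at scale \<open>h\<close>: the weight \<open>1 / (\<bar>x - z\<bar>\<^sup>2 + h\<^sup>2)\<close> is at
    least \<open>1 / (2 h\<^sup>2)\<close> on the ball, and integrating the divergence of the field
    \<open>u\<^sup>2 (x - z) / (\<bar>x - z\<bar>\<^sup>2 + h\<^sup>2)\<close>, whose integral is zero, bounds the weighted integral of
    \<open>u\<^sup>2\<close> by the energy of \<open>u\<close> (\<open>hardy_test_function\<close>, \<open>local_poincare_H10\<close>).

  The remaining work makes the function spaces usable. All integrations by parts come from one
  fact: a compactly supported Lipschitz function that is differentiable almost everywhere has partial
  derivatives with integral zero, because the integrals of its difference quotients vanish by
  translation invariance (\<open>integral_partial_lipschitz\<close>). Mollification (\<open>mollify\<close>) supplies the
  test functions, both for the uniqueness of weak gradients (\<open>weak_gradient_unique\<close>), by which the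
  chosen weak gradient can be computed, and for approximating discrete functions in the energy norm.
\<close>

section \<open>Smooth functions and bumps\<close>

lemma Ck_Suc_imp: "Ck (Suc k) f \<Longrightarrow> Ck k f"
proof (induction k arbitrary: f)
  case 0
  then show ?case by (auto intro: differentiable_imp_continuous_on)
next
  case (Suc k)
  then show ?case by simp
qed

lemma Ck_const: "Ck k (\<lambda>x::'a::euclidean_space. c)"
proof (induction k arbitrary: c)
  case (Suc k)
  have "partial (\<lambda>x::'a. c) b = (\<lambda>x. 0)" for b
    by (rule ext) (simp add: frechet_derivative_const)
  then show ?case using Suc by simp
qed simp

lemma Ck_inner: "Ck k (\<lambda>x::'a::euclidean_space. x \<bullet> v)"
proof (cases k)
  case (Suc j)
  have D: "((\<lambda>x::'a. x \<bullet> v) has_derivative (\<lambda>h. h \<bullet> v)) (at x)" for x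
    by (auto intro!: derivative_eq_intros)
  have "partial (\<lambda>x::'a. x \<bullet> v) b = (\<lambda>x. b \<bullet> v)" for b
    by (rule ext) (simp add: frechet_derivative_at[OF D, symmetric])
  moreover have "(\<lambda>x::'a. x \<bullet> v) differentiable_on UNIV"
    using D by (auto simp: differentiable_on_def differentiable_def)
  ultimately show ?thesis using Suc by (simp add: Ck_const)
qed (auto intro!: continuous_intros)

lemma partial_has_derivative:
  assumes "(f has_derivative f') (at x)" shows "partial f b x = f' b"
  using frechet_derivative_at[OF assms] by simp

lemma differentiable_on_UNIV_has_derivative:
  assumes "f differentiable_on UNIV"
  shows "(f has_derivative frechet_derivative f (at x)) (at x)"
  using assms by (simp add: differentiable_on_def frechet_derivative_works)

lemma Ck_add:
  assumes "Ck k f" "Ck k g" shows "Ck k (\<lambda>x::'a::euclidean_space. f x + g x)"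
  using assms
proof (induction k arbitrary: f g)
  case (Suc k)
  have "partial (\<lambda>x. f x + g x) b = (\<lambda>x. partial f b x + partial g b x)" for b
    using Suc.prems
    by (intro ext partial_has_derivative[OF has_derivative_add] differentiable_on_UNIV_has_derivative) auto
  then show ?case using Suc by (auto simp: differentiable_on_def)
qed (auto intro: continuous_intros)

lemma Ck_mult:
  assumes "Ck k f" "Ck k g" shows "Ck k (\<lambda>x::'a::euclidean_space. f x * g x)"
  using assms
proof (induction k arbitrary: f g)
  case (Suc k)
  have "partial (\<lambda>x. f x * g x) b = (\<lambda>x. f x * partial g b x + partial f b x * g x)" for b
    using Suc.prems
    by (intro ext partial_has_derivative[OF has_derivative_mult] differentiable_on_UNIV_has_derivative) auto
  moreover have "Ck k f" "Ck k g" using Suc.prems Ck_Suc_imp by blast+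
  ultimately show ?case using Suc by (auto simp: differentiable_on_def intro!: Ck_add)
qed (auto intro: continuous_intros)

text \<open>
  The function \<open>exp (- 1 / t)\<close> and its products with powers of \<open>1 / t\<close>, extended by zero.
  Up to linear combinations this family is closed under differentiation, which is what an induction
  over the order of differentiability needs.
\<close>

definition flat :: "nat \<Rightarrow> real \<Rightarrow> real" where
  "flat j t = (if 0 < t then (1 / t) ^ j * exp (- (1 / t)) else 0)"

lemma power_le_fact_exp:
  fixes x :: real assumes "0 \<le> x" shows "x ^ n \<le> fact n * exp x"
proof -
  have s: "summable (\<lambda>n. x ^ n /\<^sub>R fact n)" and e: "exp x = (\<Sum>n. x ^ n /\<^sub>R fact n)"
    using exp_converges[of x] by (simp_all add: sums_iff)
  have "(\<Sum>i\<in>{n}. x ^ i /\<^sub>R fact i) \<le> exp x"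
    unfolding e using assms by (intro sum_le_suminf[OF s]) auto
  then show ?thesis by (simp add: field_simps)
qed

text \<open>
  The quadratic bound yields the derivative \<open>0\<close> at the origin. It holds since \<open>exp (1 / t)\<close>
  dominates \<open>(1 / t) ^ (j + 2)\<close> up to a factorial.
\<close>

lemma flat_bounds: "0 \<le> flat j t" "flat j t \<le> fact (j + 2) * t\<^sup>2"
proof -
  show "0 \<le> flat j t" by (simp add: flat_def)
  show "flat j t \<le> fact (j + 2) * t\<^sup>2"
  proof (cases "t > 0")
    case True
    have "(1/t) ^ (j+2) \<le> fact (j + 2) * exp (1/t)"
      using True by (intro power_le_fact_exp) auto
    then have "(1/t) ^ (j+2) * exp (-(1/t)) \<le> fact (j + 2) * exp (1/t) * exp (-(1/t))"
      by (rule mult_right_mono) simp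
    moreover have "fact (j + 2) * exp (1/t) * exp (-(1/t)) = (fact (j + 2)::real)"
      unfolding mult.assoc mult_exp_exp by simp
    ultimately have "(1/t) ^ (j+2) * exp (-(1/t)) \<le> fact (j + 2)" by (rule ord_le_eq_trans)
    then have "(1/t) ^ (j+2) * exp (-(1/t)) * t\<^sup>2 \<le> fact (j + 2) * t\<^sup>2"
      by (intro mult_right_mono) auto
    moreover have "(1/t) ^ (j+2) * exp (-(1/t)) * t\<^sup>2 = (1/t) ^ j * exp (-(1/t)) * ((1/t)^2 * t^2)"
      unfolding power_add by (simp only: mult_ac)
    ultimately show ?thesis using True by (simp add: flat_def power_mult_distrib[symmetric])
  qed (simp add: flat_def)
qed

lemma flat_has_derivative:
  "(flat j has_real_derivative (flat (j + 2) t - real j * flat (j + 1) t)) (at t)"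
proof -
  consider "t > 0" | "t < 0" | "t = 0" by linarith
  then show ?thesis
  proof cases
    case 1
    have "((\<lambda>t. (1 / t) ^ j * exp (- (1 / t))) has_real_derivative
        (flat (j + 2) t - real j * flat (j + 1) t)) (at t)"
      using 1 apply (auto intro!: derivative_eq_intros simp: flat_def)
      by (cases j) (auto simp: field_simps power2_eq_square)
    then show ?thesis
      by (rule has_field_derivative_transform_within_open[where S="{0<..}"])
        (use 1 in \<open>auto simp: flat_def\<close>)
  next
    case 2
    have "((\<lambda>t. 0) has_real_derivative (flat (j + 2) t - real j * flat (j + 1) t)) (at t)"
      using 2 by (simp add: flat_def)
    then show ?thesis
      by (rule has_field_derivative_transform_within_open[where S="{..<0}"])
        (use 2 in \<open>auto simp: flat_def\<close>)
  next
    case 3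
    have "((\<lambda>h. (flat j (0 + h) - flat j 0) / h) \<longlongrightarrow> 0) (at 0)"
    proof (rule Lim_null_comparison)
      show "\<forall>\<^sub>F h in at 0. norm ((flat j (0 + h) - flat j 0) / h) \<le> fact (j + 2) * \<bar>h\<bar>"
      proof (rule always_eventually, rule allI)
        fix h :: real
        have "norm (flat j h) \<le> fact (j + 2) * \<bar>h\<bar> * \<bar>h\<bar>"
          using flat_bounds[of j h] by (simp add: power2_eq_square)
        then show "norm ((flat j (0 + h) - flat j 0) / h) \<le> fact (j + 2) * \<bar>h\<bar>"
          by (cases "h = 0") (auto simp: flat_def field_simps)
      qed
      show "((\<lambda>h::real. fact (j + 2) * \<bar>h\<bar>) \<longlongrightarrow> 0) (at 0)"
        by (auto intro!: tendsto_eq_intros)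
    qed
    then show ?thesis using 3 by (simp add: DERIV_def flat_def)
  qed
qed

lemma Ck_flat_compose:
  fixes f :: "'a::euclidean_space \<Rightarrow> real"
  assumes f: "\<And>k. Ck k f" shows "Ck k (\<lambda>x. flat j (f x))"
proof (induction k arbitrary: j)
  case 0
  have "continuous_on UNIV (flat j)"
    using flat_has_derivative by (meson DERIV_isCont continuous_at_imp_continuous_on)
  then show ?case using f[of 0] by (auto intro: continuous_on_compose2)
next
  case (Suc k)
  have fd: "f differentiable_on UNIV" "Ck k (partial f b)" if "b \<in> Basis" for b
    using f[of "Suc k"] that by auto
  then have fd1: "f differentiable_on UNIV" using nonempty_Basis by blast
  have D: "((\<lambda>x. flat j (f x)) has_derivative (\<lambda>h. (flat (j + 2) (f x) - real j * flat (j + 1) (f x)) * frechet_derivative f (at x) h)) (at x)" for x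
    using has_derivative_compose[OF differentiable_on_UNIV_has_derivative[OF fd1] flat_has_derivative[unfolded has_field_derivative_def]]
    by (simp add: o_def)
  have "partial (\<lambda>x. flat j (f x)) b = (\<lambda>x. (flat (j + 2) (f x) + (- real j) * flat (j + 1) (f x)) * partial f b x)" for b
    by (rule ext) (simp add: partial_has_derivative[OF D])
  moreover have "(\<lambda>x. flat j (f x)) differentiable_on UNIV"
    using D by (auto simp: differentiable_on_def differentiable_def)
  moreover have "Ck k (\<lambda>x. (flat (j + 2) (f x) + (- real j) * flat (j + 1) (f x)) * partial f b x)"
    if "b \<in> Basis" for b
    using fd(2)[OF that] by (rule Ck_mult[OF Ck_add[OF Suc Ck_mult[OF Ck_const Suc]]])
  ultimately show ?case by (simp only: Ck.simps) blast
qed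

lemma Ck_norm_sq: "Ck k (\<lambda>x::'a::euclidean_space. (norm x)\<^sup>2)"
proof (cases k)
  case (Suc j)
  have D: "((\<lambda>x::'a. (norm x)\<^sup>2) has_derivative (\<lambda>h. 2 * (x \<bullet> h))) (at x)" for x
    unfolding power2_norm_eq_inner
    by (auto intro!: derivative_eq_intros simp: inner_commute)
  have "partial (\<lambda>x::'a. (norm x)\<^sup>2) b = (\<lambda>x. 2 * (x \<bullet> b))" for b
    by (rule ext) (simp add: partial_has_derivative[OF D])
  moreover have "(\<lambda>x::'a. (norm x)\<^sup>2) differentiable_on UNIV"
    using D by (auto simp: differentiable_on_def differentiable_def)
  ultimately show ?thesis using Suc by (simp add: Ck_const Ck_mult Ck_inner)
qed (auto intro!: continuous_intros)

text \<open>
  The bump is \<open>exp (- 1 / (\<epsilon>\<^sup>2 - \<bar>x\<bar>\<^sup>2))\<close>, scaled to total mass one. Because it is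
  even, a convolution with it can be written both as a weighted mean of \<open>f (x + w)\<close> and with the
  derivatives falling on the bump.
\<close>

lemma mollifier_exists:
  assumes "\<epsilon> > 0"
  obtains \<eta> :: "'a::euclidean_space \<Rightarrow> real" where "\<And>k. Ck k \<eta>" "\<And>x. 0 \<le> \<eta> x" "\<And>x. \<epsilon> \<le> norm x \<Longrightarrow> \<eta> x = 0"
    "\<And>x. \<eta> (- x) = \<eta> x" "integrable lborel \<eta>" "(LINT x|lborel. \<eta> x) = 1"
proof -
  define \<rho> where "\<rho> = (\<lambda>x::'a. flat 0 (\<epsilon>\<^sup>2 + (-1) * (norm x)\<^sup>2))"
  have C: "Ck k \<rho>" for k
    unfolding \<rho>_def by (intro Ck_flat_compose Ck_add Ck_const Ck_mult Ck_norm_sq)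
  have cont: "continuous_on UNIV \<rho>" using C[of 0] by simp
  have nn: "0 \<le> \<rho> x" for x by (simp add: \<rho>_def flat_bounds)
  have z: "\<rho> x = 0" if "\<epsilon> \<le> norm x" for x
    using power_mono[OF that less_imp_le[OF assms], of 2] by (auto simp: \<rho>_def flat_def)
  have pos: "0 < \<rho> x" if "norm x < \<epsilon>" for x
    using power_strict_mono[OF that, of 2] assms by (auto simp: \<rho>_def flat_def)
  have "integrable lborel (\<lambda>x. indicator (cball 0 \<epsilon>) x *\<^sub>R \<rho> x)"
    by (intro borel_integrable_compact continuous_on_subset[OF cont]) auto
  moreover have "(\<lambda>x. indicator (cball 0 \<epsilon>) x *\<^sub>R \<rho> x) = \<rho>"
    using z by (auto simp: indicator_def fun_eq_iff)
  ultimately have int: "integrable lborel \<rho>" by simp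
  have "(LINT x|lborel. \<rho> x) \<noteq> 0"
  proof
    assume "(LINT x|lborel. \<rho> x) = 0"
    then have "AE x in lborel. \<rho> x = 0"
      using int nn by (subst (asm) integral_nonneg_eq_0_iff_AE) auto
    then have "AE x in lborel. x \<notin> ball (0::'a) \<epsilon>"
      by eventually_elim (use pos in force)
    then have "AE x in lebesgue. x \<notin> ball (0::'a) \<epsilon>"
      by (rule AE_completion)
    then have "negligible (ball (0::'a) \<epsilon>)"
      unfolding negligible_iff_null_sets by (subst AE_iff_null_sets) auto
    then show False using assms open_not_negligible[of "ball (0::'a) \<epsilon>"] by simp
  qed
  then have Ip: "(LINT x|lborel. \<rho> x) > 0"
    using integral_nonneg_AE[of \<rho> lborel] nn by fastforce
  define c where "c = 1 / (LINT x|lborel. \<rho> x)"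
  show ?thesis
  proof (rule that[of "\<lambda>x. c * \<rho> x"])
    show "(LINT x|lborel. c * \<rho> x) = 1" using Ip by (simp add: c_def)
    show "Ck k (\<lambda>x. c * \<rho> x)" for k by (rule Ck_mult[OF Ck_const C])
    show "0 \<le> c * \<rho> x" for x using nn Ip by (simp add: c_def)
    show "c * \<rho> x = 0" if "\<epsilon> \<le> norm x" for x using z[OF that] by simp
    show "c * \<rho> (- x) = c * \<rho> x" for x by (simp add: \<rho>_def)
    show "integrable lborel (\<lambda>x. c * \<rho> x)" using int by simp
  qed
qed

section \<open>Mollification of Lipschitz functions\<close>

lemma integrable_continuous_compact_support:
  fixes f :: "'a::euclidean_space \<Rightarrow> 'b::{banach, second_countable_topology}"
  assumes "continuous_on UNIV f" "compact S" "\<And>x. x \<notin> S \<Longrightarrow> f x = 0"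
  shows "integrable lborel f"
proof -
  have "integrable lborel (\<lambda>x. indicator S x *\<^sub>R f x)"
    by (intro borel_integrable_compact assms continuous_on_subset[OF assms(1)]) auto
  moreover have "(\<lambda>x. indicator S x *\<^sub>R f x) = f"
    using assms(3) by (auto simp: indicator_def fun_eq_iff)
  ultimately show ?thesis by simp
qed

lemma lborel_integral_shift:
  fixes f :: "'a::euclidean_space \<Rightarrow> real"
  assumes [measurable]: "f \<in> borel_measurable borel"
  shows "(LINT y|lborel. f (x + y)) = (LINT y|lborel. f y)"
proof -
  have "(LINT y|lborel. f y) = (LINT y|distr lborel borel ((+) x). f y)"
    by (simp add: lborel_distr_plus)
  also have "\<dots> = (LINT y|lborel. f (x + y))"
    by (rule integral_distr) auto
  finally show ?thesis by simp
qed

text \<open>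
  Differentiation under the integral sign. The integrand is wrapped into bounded linear maps, the form
  in which the Leibniz rule for parameter integrals is stated.
\<close>

lemma convolution_has_derivative:
  fixes \<psi> :: "'a::euclidean_space \<Rightarrow> real"
  assumes f: "continuous_on (cbox a b) f" and \<psi>: "Ck 1 \<psi>"
  shows "((\<lambda>x. integral (cbox a b) (\<lambda>y. f y * \<psi> (x - y))) has_derivative
    (\<lambda>h. integral (cbox a b) (\<lambda>y. f y * frechet_derivative \<psi> (at (x - y)) h))) (at x)"
proof -
  define G where "G z = (\<Sum>b\<in>Basis. partial \<psi> b z *\<^sub>R b)" for z
  have \<psi>d: "\<psi> differentiable_on UNIV" and \<psi>p: "continuous_on UNIV (partial \<psi> b)" if "b \<in> Basis" for b
    using \<psi> that by auto
  have D: "(\<psi> has_derivative frechet_derivative \<psi> (at z)) (at z)" for z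
    using \<psi> by (intro differentiable_on_UNIV_has_derivative) auto
  have G: "frechet_derivative \<psi> (at z) h = h \<bullet> G z" for z h
  proof -
    have "linear (frechet_derivative \<psi> (at z))"
      using D has_derivative_linear by blast
    then have "frechet_derivative \<psi> (at z) (\<Sum>b\<in>Basis. (h \<bullet> b) *\<^sub>R b) = (\<Sum>b\<in>Basis. (h \<bullet> b) *\<^sub>R partial \<psi> b z)"
      by (simp add: linear_sum linear_scale)
    then show ?thesis by (simp add: G_def euclidean_representation inner_sum_right mult.commute)
  qed
  have cG: "continuous_on UNIV G"
    unfolding G_def using \<psi>p by (intro continuous_intros)
  have c\<psi>: "continuous_on UNIV \<psi>" using D
    by (meson continuous_at_imp_continuous_on has_derivative_continuous)
  have blin: "blinfun_apply (blinfun_inner_right v) h = h \<bullet> v" for v h :: 'a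
    by (simp add: inner_commute)
  define fx where "fx x y = f y *\<^sub>R blinfun_inner_right (G (x - y))" for x y
  have cfx: "continuous_on (UNIV \<times> cbox a b) (\<lambda>(x, y). fx x y)"
    unfolding fx_def case_prod_beta
    by (intro continuous_intros continuous_on_compose2[OF f]
        bounded_linear.continuous_on[OF bounded_linear_blinfun_inner_right]
        continuous_on_compose2[OF cG]) auto
  have cfx': "continuous_on (cbox a b) (fx x)" for x
    unfolding fx_def
    by (intro continuous_intros continuous_on_compose2[OF f]
        bounded_linear.continuous_on[OF bounded_linear_blinfun_inner_right]
        continuous_on_compose2[OF cG]) auto
  have "((\<lambda>x. integral (cbox a b) (\<lambda>y. f y * \<psi> (x - y))) has_derivative
    integral (cbox a b) (fx x)) (at x within UNIV)"
  proof (rule leibniz_rule[OF _ _ cfx])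
    fix x y assume "y \<in> cbox a b"
    have "((\<lambda>x. \<psi> (x - y)) has_derivative (\<lambda>h. frechet_derivative \<psi> (at (x - y)) h)) (at x)"
      by (rule has_derivative_compose[OF _ D, of "\<lambda>x. x - y", THEN has_derivative_eq_rhs])
        (auto intro!: derivative_eq_intros)
    then show "((\<lambda>x. f y * \<psi> (x - y)) has_derivative blinfun_apply (fx x y)) (at x within UNIV)"
      by (auto simp: fx_def blinfun.scaleR_left G inner_commute intro!: derivative_eq_intros)
  next
    show "(\<lambda>y. f y * \<psi> (x - y)) integrable_on cbox a b" for x
      by (intro integrable_continuous continuous_intros f continuous_on_compose2[OF c\<psi>]) auto
  qed auto
  moreover have "blinfun_apply (integral (cbox a b) (fx x)) h =
      integral (cbox a b) (\<lambda>y. f y * frechet_derivative \<psi> (at (x - y)) h)" for h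
    by (subst blinfun_apply_integral[OF integrable_continuous[OF cfx']])
      (simp add: fx_def blinfun.scaleR_left G inner_commute)
  ultimately show ?thesis by (simp add: has_derivative_eq_rhs fun_eq_iff)
qed

lemma Ck_convolution:
  fixes \<psi> :: "'a::euclidean_space \<Rightarrow> real"
  assumes f: "continuous_on (cbox a b) f" and \<psi>: "\<And>k. Ck k \<psi>"
  shows "Ck k (\<lambda>x. integral (cbox a b) (\<lambda>y. f y * \<psi> (x - y)))"
  using \<psi>
proof (induction k arbitrary: \<psi>)
  case 0
  have "(\<lambda>x. integral (cbox a b) (\<lambda>y. f y * \<psi> (x - y))) differentiable_on UNIV"
    using convolution_has_derivative[OF f 0[of 1]]
    by (auto simp: differentiable_on_def differentiable_def)
  then show ?case by (simp add: differentiable_imp_continuous_on)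
next
  case (Suc k)
  note D = convolution_has_derivative[OF f Suc.prems[of 1]]
  have "Ck j (partial \<psi> b)" if "b \<in> Basis" for b j
    using Suc.prems[of "Suc j"] that by simp
  then have "Ck k (\<lambda>x. integral (cbox a b) (\<lambda>y. f y * partial \<psi> c (x - y)))" if "c \<in> Basis" for c
    using that by (intro Suc.IH) auto
  moreover have "(\<lambda>x. integral (cbox a b) (\<lambda>y. f y * \<psi> (x - y))) differentiable_on UNIV"
    using D by (auto simp: differentiable_on_def differentiable_def)
  moreover have "partial (\<lambda>x. integral (cbox a b) (\<lambda>y. f y * \<psi> (x - y))) c =
      (\<lambda>x. integral (cbox a b) (\<lambda>y. f y * partial \<psi> c (x - y)))" for c
    by (rule ext) (rule partial_has_derivative[OF D])
  ultimately show ?case by simp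
qed

text \<open>
  Convolution with a bump of radius \<open>\<epsilon>\<close> is an average over small translations. Every estimate
  below is therefore inherited from \<open>f\<close>: averages keep the Lipschitz constant, move values
  by at most \<open>L * \<epsilon>\<close>, and reproduce affine functions up to an additive constant, so the exact
  gradient survives wherever \<open>f\<close> is affine on a larger ball.
\<close>

lemma mollify:
  fixes f :: "'a::euclidean_space \<Rightarrow> real"
  assumes f: "L-lipschitz_on UNIV f" and bf: "bounded {x. f x \<noteq> 0}" and \<epsilon>: "0 < \<epsilon>"
  obtains \<phi> where "\<And>k. Ck k \<phi>" "L-lipschitz_on UNIV \<phi>" "\<And>x. \<bar>\<phi> x - f x\<bar> \<le> L * \<epsilon>"
    "\<And>x. \<phi> x \<noteq> 0 \<Longrightarrow> \<exists>y. f y \<noteq> 0 \<and> dist x y < \<epsilon>"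
    "\<And>x r a c. \<epsilon> < r \<Longrightarrow> (\<And>y. y \<in> ball x r \<Longrightarrow> f y = a \<bullet> y + c) \<Longrightarrow>
      (\<phi> has_derivative (\<lambda>h. a \<bullet> h)) (at x)"
proof -
  obtain \<eta> :: "'a \<Rightarrow> real" where \<eta>C: "\<And>k. Ck k \<eta>" and \<eta>0: "\<And>x. 0 \<le> \<eta> x"
    and \<eta>z: "\<And>x. \<epsilon> \<le> norm x \<Longrightarrow> \<eta> x = 0" and \<eta>e: "\<And>x. \<eta> (- x) = \<eta> x"
    and \<eta>i: "integrable lborel \<eta>" and \<eta>1: "(LINT x|lborel. \<eta> x) = 1"
    using mollifier_exists[OF \<epsilon>] by blast
  have \<eta>c: "continuous_on UNIV \<eta>" using \<eta>C[of 0] by simp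
  have fc: "continuous_on UNIV f" using f lipschitz_on_continuous_on by blast
  have int: "integrable lborel (\<lambda>w. u w * \<eta> w)" if "continuous_on UNIV u" for u
    by (rule integrable_continuous_compact_support[of _ "cball 0 \<epsilon>"])
      (use that \<eta>c \<eta>z in \<open>auto intro!: continuous_intros\<close>)
  have avg: "\<bar>LINT w|lborel. u w * \<eta> w\<bar> \<le> M"
    if u: "continuous_on UNIV u" and M: "\<And>w. norm w < \<epsilon> \<Longrightarrow> \<bar>u w\<bar> \<le> M" for u M
  proof -
    have "\<bar>LINT w|lborel. u w * \<eta> w\<bar> \<le> (LINT w|lborel. \<bar>u w * \<eta> w\<bar>)"
      by (rule integral_abs_bound)
    also have "\<dots> \<le> (LINT w|lborel. M * \<eta> w)"
    proof (rule integral_mono)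
      show "\<bar>u w * \<eta> w\<bar> \<le> M * \<eta> w" for w
        using M[of w] \<eta>0[of w] \<eta>z[of w] by (cases "norm w < \<epsilon>") (auto simp: abs_mult mult_right_mono)
    qed (use int[OF u] \<eta>i in auto)
    finally show ?thesis using \<eta>1 by simp
  qed
  define \<phi> where "\<phi> x = (LINT w|lborel. f (x + w) * \<eta> w)" for x
  have cs: "continuous_on UNIV (\<lambda>w. f (x + w))" for x
    by (intro continuous_on_compose2[OF fc] continuous_intros) auto
  have diff: "\<bar>\<phi> x - \<phi> y\<bar> \<le> L * dist x y" for x y
  proof -
    have "\<phi> x - \<phi> y = (LINT w|lborel. (f (x + w) - f (y + w)) * \<eta> w)"
      unfolding \<phi>_def left_diff_distrib by (rule Bochner_Integration.integral_diff[symmetric]) (intro int cs)+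
    also have "\<bar>\<dots>\<bar> \<le> L * dist x y"
      using lipschitz_onD[OF f, of "x + w" "y + w" for w]
      by (intro avg continuous_intros cs) (auto simp: dist_norm)
    finally show ?thesis .
  qed
  obtain a where a: "{x. f x \<noteq> 0} \<subseteq> cbox (-a) a"
    using bounded_subset_cbox_symmetric[OF bf] by blast
  have eq: "\<phi> x = integral (cbox (-a) a) (\<lambda>y. f y * \<eta> (x - y))" for x
  proof -
    have c2: "continuous_on UNIV (\<lambda>y. f y * \<eta> (y - x))"
      by (intro continuous_intros fc continuous_on_compose2[OF \<eta>c]) auto
    have "\<phi> x = (LINT w|lborel. (\<lambda>y. f y * \<eta> (y - x)) (x + w))"
      by (simp add: \<phi>_def)
    also have "\<dots> = (LINT y|lborel. f y * \<eta> (y - x))"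
      by (rule lborel_integral_shift) (use c2 in \<open>auto intro: borel_measurable_continuous_onI\<close>)
    also have "\<dots> = (LINT y|lborel. f y * \<eta> (x - y))"
      using \<eta>e[of "x - y" for y] by simp
    finally have 1: "\<phi> x = (LINT y|lborel. f y * \<eta> (x - y))" .
    have c3: "continuous_on UNIV (\<lambda>y. f y * \<eta> (x - y))"
      by (intro continuous_intros fc continuous_on_compose2[OF \<eta>c]) auto
    have "integrable lborel (\<lambda>y. f y * \<eta> (x - y))"
      by (rule integrable_continuous_compact_support[OF c3, of "cbox (-a) a"]) (use a in auto)
    then have "((\<lambda>y. f y * \<eta> (x - y)) has_integral \<phi> x) UNIV"
      unfolding 1 by (rule has_integral_integral_lborel)
    moreover have "((\<lambda>y. f y * \<eta> (x - y)) has_integral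
        integral (cbox (-a) a) (\<lambda>y. f y * \<eta> (x - y))) UNIV"
      by (rule has_integral_on_superset[OF integrable_integral])
        (use a in \<open>auto intro!: integrable_continuous continuous_on_subset[OF c3]\<close>)
    ultimately show ?thesis by (rule has_integral_unique)
  qed
  show ?thesis
  proof (rule that[of \<phi>])
    show "Ck k \<phi>" for k
      unfolding eq[abs_def] by (rule Ck_convolution[OF continuous_on_subset[OF fc] \<eta>C]) auto
    show "L-lipschitz_on UNIV \<phi>"
      using diff lipschitz_on_nonneg[OF f] by (auto intro!: lipschitz_onI simp: dist_real_def)
    show "\<bar>\<phi> x - f x\<bar> \<le> L * \<epsilon>" for x
    proof -
      have "f x = (LINT w|lborel. f x * \<eta> w)" using \<eta>1 by simp
      then have "\<phi> x - f x = (LINT w|lborel. f (x + w) * \<eta> w) - (LINT w|lborel. f x * \<eta> w)"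
        by (simp add: \<phi>_def)
      also have "\<dots> = (LINT w|lborel. (f (x + w) - f x) * \<eta> w)"
        unfolding left_diff_distrib by (rule Bochner_Integration.integral_diff[symmetric]) (intro int cs continuous_intros)+
      also have "\<bar>\<dots>\<bar> \<le> L * \<epsilon>"
      proof (rule avg)
        fix w :: 'a assume "norm w < \<epsilon>"
        have "\<bar>f (x + w) - f x\<bar> \<le> L * norm w"
          using lipschitz_onD[OF f, of "x + w" x] by (simp add: dist_norm)
        also have "\<dots> \<le> L * \<epsilon>"
          using \<open>norm w < \<epsilon>\<close> lipschitz_on_nonneg[OF f] by (intro mult_left_mono) auto
        finally show "\<bar>f (x + w) - f x\<bar> \<le> L * \<epsilon>" .
      qed (intro continuous_intros cs)
      finally show ?thesis .
    qed
    show "\<exists>y. f y \<noteq> 0 \<and> dist x y < \<epsilon>" if nz: "\<phi> x \<noteq> 0" for x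
    proof (rule ccontr)
      assume "\<not> ?thesis"
      then have "f (x + w) = 0" if "norm w < \<epsilon>" for w
        using that by (auto simp: dist_norm dest: spec[of _ "x + w"])
      then have "f (x + w) * \<eta> w = 0" for w
        using \<eta>z[of w] by (cases "norm w < \<epsilon>") auto
      then have "(\<lambda>w. f (x + w) * \<eta> w) = (\<lambda>w. 0)" by (rule ext)
      then show False using nz by (simp add: \<phi>_def)
    qed
    show "(\<phi> has_derivative (\<lambda>h. v \<bullet> h)) (at x)"
      if r: "\<epsilon> < r" and aff: "\<And>y. y \<in> ball x r \<Longrightarrow> f y = v \<bullet> y + c" for x r v c
    proof (rule has_derivative_transform_within_open[where s="ball x (r - \<epsilon>)"])
      show "((\<lambda>y. v \<bullet> y + (LINT w|lborel. (v \<bullet> w + c) * \<eta> w)) has_derivative (\<lambda>h. v \<bullet> h)) (at x)"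
        by (auto intro!: derivative_eq_intros)
      fix y assume y: "y \<in> ball x (r - \<epsilon>)"
      have "f (y + w) * \<eta> w = (v \<bullet> y) * \<eta> w + (v \<bullet> w + c) * \<eta> w" for w
      proof (cases "norm w < \<epsilon>")
        case True
        have "dist x (y + w) \<le> dist x y + dist y (y + w)" by (rule dist_triangle)
        then have "y + w \<in> ball x r" using True y by (simp add: dist_norm)
        from aff[OF this] show ?thesis by (simp add: algebra_simps inner_add_right)
      qed (use \<eta>z in auto)
      then have "\<phi> y = (LINT w|lborel. (v \<bullet> y) * \<eta> w + (v \<bullet> w + c) * \<eta> w)"
        by (simp add: \<phi>_def)
      also have "\<dots> = (LINT w|lborel. (v \<bullet> y) * \<eta> w) + (LINT w|lborel. (v \<bullet> w + c) * \<eta> w)"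
        by (rule Bochner_Integration.integral_add) (intro int continuous_intros)+
      finally show "v \<bullet> y + (LINT w|lborel. (v \<bullet> w + c) * \<eta> w) = \<phi> y" using \<eta>1 by simp
    qed (use r \<epsilon> in auto)
  qed
qed

section \<open>Weak gradients of Lipschitz functions\<close>

definition grad :: "(real^'n::finite \<Rightarrow> real) \<Rightarrow> real^'n \<Rightarrow> real^'n" where
  "grad u x = (\<chi> i. partial u (axis i 1) x)"

lemma frechet_derivative_grad:
  assumes "u differentiable (at x)"
  shows "frechet_derivative u (at x) h = grad u x \<bullet> h"
proof -
  have "linear (frechet_derivative u (at x))"
    using assms frechet_derivative_works has_derivative_linear by blast
  then have "frechet_derivative u (at x) (\<Sum>i\<in>UNIV. h $ i *\<^sub>R axis i 1) = (\<Sum>i\<in>UNIV. h $ i * partial u (axis i 1) x)"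
    by (simp add: linear_sum linear_scale)
  moreover have "(\<Sum>i\<in>UNIV. h $ i *\<^sub>R axis i 1) = h"
    using basis_expansion[of h] by (simp add: scalar_mult_eq_scaleR)
  ultimately show ?thesis by (simp add: grad_def inner_vec_def mult.commute)
qed

lemma has_derivative_grad:
  assumes "u differentiable (at x)"
  shows "(u has_derivative (\<lambda>h. grad u x \<bullet> h)) (at x)"
  using assms frechet_derivative_grad[OF assms] frechet_derivative_works[of u "at x"]
  by (metis (no_types, lifting) has_derivative_eq_rhs ext)

lemma grad_eqI:
  assumes "(u has_derivative (\<lambda>h. v \<bullet> h)) (at x)" shows "grad u x = v"
  by (simp add: grad_def vec_eq_iff partial_has_derivative[OF assms] inner_axis)

lemma partial_zero_off_support:
  assumes "x \<notin> closure {y. u y \<noteq> 0}"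
  shows "partial u b x = 0"
proof (rule partial_has_derivative)
  show "(u has_derivative (\<lambda>h. 0)) (at x)"
    by (rule has_derivative_transform_within_open[where f="\<lambda>_. 0" and s="- closure {y. u y \<noteq> 0}"])
      (use assms closure_subset[of "{y. u y \<noteq> 0}"] in auto)
qed

lemma grad_zero_off_support:
  assumes "x \<notin> closure {y. u y \<noteq> 0}" shows "grad u x = 0"
  using partial_zero_off_support[OF assms] by (simp add: grad_def vec_eq_iff)

lemma lipschitz_bounded_support_bounded:
  fixes f :: "'a::euclidean_space \<Rightarrow> real"
  assumes "L-lipschitz_on UNIV f" "bounded {x. f x \<noteq> 0}"
  obtains B where "0 \<le> B" "\<And>x. \<bar>f x\<bar> \<le> B"
proof -
  have "compact (closure {x. f x \<noteq> 0})" using assms(2) by simp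
  moreover have "continuous_on (closure {x. f x \<noteq> 0}) f"
    using assms(1) by (meson lipschitz_on_continuous_on continuous_on_subset subset_UNIV)
  ultimately have "bounded (f ` closure {x. f x \<noteq> 0})"
    by (intro compact_imp_bounded compact_continuous_image)
  then obtain B where B: "0 < B" "\<And>x. x \<in> closure {x. f x \<noteq> 0} \<Longrightarrow> \<bar>f x\<bar> \<le> B"
    unfolding bounded_pos by auto
  have "\<bar>f x\<bar> \<le> B" for x
    using B(1) B(2)[of x] closure_subset[of "{x. f x \<noteq> 0}"] by (cases "f x = 0") auto
  then show ?thesis using B(1) that[of B] by auto
qed

lemma lipschitz_on_mult_bounded:
  fixes f g :: "'a::metric_space \<Rightarrow> real"
  assumes f: "L-lipschitz_on UNIV f" and g: "M-lipschitz_on UNIV g"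
    and B: "\<And>x. \<bar>f x\<bar> \<le> A" "\<And>x. \<bar>g x\<bar> \<le> B"
  shows "(A * M + B * L)-lipschitz_on UNIV (\<lambda>x. f x * g x)"
proof (rule lipschitz_onI)
  have nn: "0 \<le> A" "0 \<le> B" using B[of undefined] by linarith+
  show "0 \<le> A * M + B * L"
    using nn lipschitz_on_nonneg[OF f] lipschitz_on_nonneg[OF g] by simp
  fix x y
  have "f x * g x - f y * g y = f x * (g x - g y) + g y * (f x - f y)"
    by (simp add: algebra_simps)
  then have "\<bar>f x * g x - f y * g y\<bar> \<le> \<bar>f x\<bar> * \<bar>g x - g y\<bar> + \<bar>g y\<bar> * \<bar>f x - f y\<bar>"
    by (metis abs_mult abs_triangle_ineq)
  also have "\<dots> \<le> A * (M * dist x y) + B * (L * dist x y)"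
    using lipschitz_onD[OF f, of x y] lipschitz_onD[OF g, of x y] nn
    by (intro add_mono mult_mono B) (auto simp: dist_real_def)
  finally show "dist (f x * g x) (f y * g y) \<le> (A * M + B * L) * dist x y"
    by (simp add: dist_real_def algebra_simps)
qed

lemma difference_quotient_LIMSEQ:
  assumes d: "f differentiable (at x)"
  shows "(\<lambda>n. (f (x + (1 / real (Suc n)) *\<^sub>R b) - f x) / (1 / real (Suc n))) \<longlonglongrightarrow> partial f b x"
proof (rule filterlim_compose[where g="\<lambda>t. (f (x + t *\<^sub>R b) - f x) / t" and f="\<lambda>n. 1 / real (Suc n)"])
    have D: "(f has_derivative frechet_derivative f (at x)) (at x)"
      using d frechet_derivative_works by blast
    have "((\<lambda>t. f (x + t *\<^sub>R b)) has_derivative (\<lambda>t. frechet_derivative f (at x) (t *\<^sub>R b))) (at 0)"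
      by (rule has_derivative_compose[of "\<lambda>t. x + t *\<^sub>R b" "\<lambda>t. t *\<^sub>R b" 0 UNIV])
        (use D in \<open>auto intro!: derivative_eq_intros\<close>)
    moreover have "frechet_derivative f (at x) (t *\<^sub>R b) = t * partial f b x" for t
      using has_derivative_linear[OF D] by (simp add: linear_scale)
    ultimately have "((\<lambda>t. f (x + t *\<^sub>R b)) has_real_derivative partial f b x) (at 0)"
      by (simp add: has_field_derivative_def mult_commute_abs)
    then show "((\<lambda>t. (f (x + t *\<^sub>R b) - f x) / t) \<longlongrightarrow> partial f b x) (at 0)"
      by (simp add: DERIV_def)
    show "filterlim (\<lambda>n. 1 / real (Suc n)) (at 0) sequentially"
      unfolding filterlim_at using lim_inverse_n' LIMSEQ_Suc[OF lim_inverse_n'] by auto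
  qed

lemma difference_quotient_bound:
  fixes f :: "'a::real_normed_vector \<Rightarrow> real"
  assumes f: "L-lipschitz_on UNIV f" and t: "t \<noteq> 0"
  shows "\<bar>(f (x + t *\<^sub>R b) - f x) / t\<bar> \<le> L * norm b"
  using lipschitz_onD[OF f, of "x + t *\<^sub>R b" x] t
  by (simp add: dist_norm dist_real_def abs_divide divide_le_eq mult_ac)

lemma partial_lipschitz_bound:
  assumes f: "L-lipschitz_on UNIV f" and d: "f differentiable (at x)"
  shows "\<bar>partial f b x\<bar> \<le> L * norm b"
proof -
  note difference_quotient_LIMSEQ[OF d]
  then have "(\<lambda>n. \<bar>(f (x + (1 / real (Suc n)) *\<^sub>R b) - f x) / (1 / real (Suc n))\<bar>) \<longlonglongrightarrow> \<bar>partial f b x\<bar>"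
    by (rule tendsto_rabs)
  moreover have "\<bar>(f (x + (1 / real (Suc n)) *\<^sub>R b) - f x) / (1 / real (Suc n))\<bar> \<le> L * norm b" for n
    by (rule difference_quotient_bound[OF f]) simp
  ultimately show ?thesis by (intro LIMSEQ_le_const2) auto
qed

text \<open>
  Difference quotients of \<open>f\<close> have integral zero by translation invariance, are bounded by a
  multiple of the indicator of a fixed ball, and converge almost everywhere to the partial derivative;
  dominated convergence does the rest. Measurability of the partial derivative also comes from this
  limit.
\<close>

lemma integral_partial_lipschitz:
  fixes f :: "'a::euclidean_space \<Rightarrow> real"
  assumes f: "L-lipschitz_on UNIV f" and bs: "bounded {x. f x \<noteq> 0}"
    and d: "AE x in lebesgue. f differentiable (at x)"
  shows "integrable lebesgue (partial f b)" "(LINT x|lebesgue. partial f b x) = 0"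
proof -
  have fc: "continuous_on UNIV f" using f lipschitz_on_continuous_on by blast
  obtain R where R: "\<And>x. f x \<noteq> 0 \<Longrightarrow> norm x \<le> R" using bs unfolding bounded_iff by auto
  define s where "s n x = (f (x + (1 / real (Suc n)) *\<^sub>R b) - f x) / (1 / real (Suc n))" for n x
  define w where "w x = L * norm b * indicator (cball (0::'a) (R + norm b)) x" for x
  have scont: "continuous_on UNIV (s n)" for n
    unfolding s_def by (intro continuous_intros continuous_on_compose2[OF fc]) auto
  have sm: "s n \<in> borel_measurable borel" for n
    using scont by (rule borel_measurable_continuous_onI)
  have wi: "integrable lebesgue w"
    unfolding w_def
    by (intro integrable_mult_right) (simp add: lmeasurable_iff_integrable[symmetric])
  have sb: "norm (s n x) \<le> w x" for n x
  proof (cases "x \<in> cball 0 (R + norm b)")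
    case True
    then show ?thesis
      using difference_quotient_bound[OF f, of "1 / real (Suc n)" x b]
      by (simp add: s_def w_def)
  next
    case False
    have "norm ((1 / real (Suc n)) *\<^sub>R b) \<le> norm b" by (simp add: field_simps)
    then have "norm x \<le> norm (x + (1 / real (Suc n)) *\<^sub>R b) + norm b"
      using norm_triangle_ineq4[of "x + (1 / real (Suc n)) *\<^sub>R b" "(1 / real (Suc n)) *\<^sub>R b"] by simp
    then have "f (x + (1 / real (Suc n)) *\<^sub>R b) = 0" using False R[of "x + (1 / real (Suc n)) *\<^sub>R b"] by force
    moreover have "f x = 0" using False R[of x] norm_ge_zero[of b] by fastforce
    ultimately show ?thesis using False by (simp add: s_def w_def)
  qed
  have lim: "AE x in lebesgue. (\<lambda>n. s n x) \<longlonglongrightarrow> partial f b x"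
    using d by eventually_elim (unfold s_def, rule difference_quotient_LIMSEQ)
  have "(\<lambda>x. lim (\<lambda>n. s n x)) \<in> borel_measurable lebesgue"
    using sm by (intro borel_measurable_lim_metric) (simp add: measurable_completion)
  moreover have "AE x in lebesgue. lim (\<lambda>n. s n x) = partial f b x"
    using lim by eventually_elim (rule limI)
  ultimately have pm: "partial f b \<in> borel_measurable lebesgue" by (rule borel_measurable_AE)
  show "integrable lebesgue (partial f b)"
    by (rule integrable_dominated_convergence[OF pm _ wi lim])
      (use sm sb in \<open>auto simp: measurable_completion\<close>)
  have "(\<lambda>n. LINT x|lebesgue. s n x) \<longlonglongrightarrow> (LINT x|lebesgue. partial f b x)"
    by (rule integral_dominated_convergence[OF pm _ wi lim])
      (use sm sb in \<open>auto simp: measurable_completion\<close>)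
  moreover have "(LINT x|lebesgue. s n x) = 0" for n
  proof -
    have fm: "f \<in> borel_measurable borel" using fc by (rule borel_measurable_continuous_onI)
    have fi: "integrable lborel f"
      by (rule integrable_continuous_compact_support[OF fc, of "cball 0 R"]) (use R in force)+
    define e where "e = (1 / real (Suc n)) *\<^sub>R b"
    have fe: "integrable lborel (\<lambda>x. f (e + x))"
    proof (rule integrable_continuous_compact_support[of _ "cball (- e) R"])
      show "continuous_on UNIV (\<lambda>x. f (e + x))"
        by (intro continuous_on_compose2[OF fc] continuous_intros) auto
      fix x assume "x \<notin> cball (- e) R"
      moreover have "dist (- e) x = norm (e + x)"
        by (metis add.commute diff_minus_eq_add dist_commute dist_norm)
      ultimately show "f (e + x) = 0" using R[of "e + x"] by auto
    qed simp
    have "(LINT x|lebesgue. s n x) = (LINT x|lborel. s n x)"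
      using sm by (intro integral_completion) auto
    also have "\<dots> = (LINT x|lborel. f (e + x) - f x) / (1 / real (Suc n))"
      by (simp add: s_def e_def add.commute)
    also have "(LINT x|lborel. f (e + x) - f x) = 0"
      using fi fe lborel_integral_shift[OF fm, of e] by simp
    finally show ?thesis by simp
  qed
  ultimately show "(LINT x|lebesgue. partial f b x) = 0" by (simp add: LIMSEQ_const_iff)
qed

lemma integrable_lebesgue_continuous_compact_support:
  fixes f :: "'a::euclidean_space \<Rightarrow> 'b::{banach, second_countable_topology}"
  assumes "continuous_on UNIV f" "compact S" "\<And>x. x \<notin> S \<Longrightarrow> f x = 0"
  shows "integrable lebesgue f"
proof -
  have "f \<in> borel_measurable lborel" using assms(1) by (simp add: borel_measurable_continuous_onI)
  then show ?thesis
    using integrable_continuous_compact_support[OF assms] by (rule integrable_completion[THEN iffD2])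
qed

lemma lipschitz_C1_bounded_support:
  fixes f :: "real^'n::finite \<Rightarrow> real"
  assumes D: "\<And>x. f differentiable (at x)" and c: "continuous_on UNIV (grad f)"
    and bs: "bounded {x. f x \<noteq> 0}"
  obtains L where "L-lipschitz_on UNIV f"
proof -
  have "bounded (grad f ` closure {x. f x \<noteq> 0})"
    using bs by (intro compact_imp_bounded compact_continuous_image continuous_on_subset[OF c]) auto
  then obtain B where B: "0 < B" "\<And>x. x \<in> closure {x. f x \<noteq> 0} \<Longrightarrow> norm (grad f x) \<le> B"
    unfolding bounded_pos by auto
  have "norm (grad f x) \<le> B" for x
    using B grad_zero_off_support[of x f] by (cases "x \<in> closure {x. f x \<noteq> 0}") auto
  then have "\<bar>grad f x \<bullet> h\<bar> \<le> B * norm h" for x h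
    using Cauchy_Schwarz_ineq2[of "grad f x" h] mult_right_mono[of "norm (grad f x)" B "norm h"]
    by fastforce
  then have "onorm (\<lambda>h. grad f x \<bullet> h) \<le> B" for x
    using B(1) by (intro onorm_bound) auto
  then have "B-lipschitz_on UNIV f"
    using B(1) has_derivative_grad[OF D]
    by (intro bounded_derivative_imp_lipschitz[where f'="\<lambda>x h. grad f x \<bullet> h"]) auto
  then show ?thesis by (rule that)
qed

lemma test_functionD:
  assumes "\<phi> \<in> test_functions U"
  shows "\<phi> differentiable (at x)" "continuous_on UNIV \<phi>" "continuous_on UNIV (partial \<phi> (axis i 1))"
    "continuous_on UNIV (grad \<phi>)"
    "bounded {x. \<phi> x \<noteq> 0}" "compact (closure {x. \<phi> x \<noteq> 0})" "closure {x. \<phi> x \<noteq> 0} \<subseteq> U" "\<exists>L. L-lipschitz_on UNIV \<phi>"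
proof -
  have C: "Ck k \<phi>" for k using assms by (simp add: test_functions_def)
  show d: "\<phi> differentiable (at x)" for x using C[of "Suc 0"] by (simp add: differentiable_on_def)
  show "continuous_on UNIV \<phi>" using C[of 0] by simp
  show p: "continuous_on UNIV (partial \<phi> (axis i 1))" for i
    using C[of "Suc 0"] by (auto simp: axis_in_Basis_iff)
  show g: "continuous_on UNIV (grad \<phi>)"
    unfolding grad_def[abs_def] using p by (intro continuous_on_vec_lambda) auto
  show "compact (closure {x. \<phi> x \<noteq> 0})" "closure {x. \<phi> x \<noteq> 0} \<subseteq> U"
    using assms by (auto simp: test_functions_def)
  then show b: "bounded {x. \<phi> x \<noteq> 0}" by simp
  show "\<exists>L. L-lipschitz_on UNIV \<phi>"
    using lipschitz_C1_bounded_support[OF d g b] by blast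
qed

lemma absolutely_integrable_if_integrable:
  assumes "integrable lebesgue f" "S \<in> sets lebesgue" shows "f absolutely_integrable_on S"
  using assms by (simp add: set_integrable_def integrable_mult_indicator)

lemma integral_lebesgue_on_eq:
  fixes f :: "'a::euclidean_space \<Rightarrow> 'b::euclidean_space"
  assumes "S \<in> sets lebesgue" "\<And>x. x \<notin> S \<Longrightarrow> f x = 0"
  shows "(LINT x|lebesgue_on S. f x) = (LINT x|lebesgue. f x)"
proof -
  have "(\<lambda>x. if x \<in> S then f x else 0) = f" using assms(2) by auto
  then show ?thesis using Lebesgue_Measure.integral_restrict_UNIV[OF assms(1), of f] by simp
qed

lemma integrable_grad_lipschitz:
  fixes u :: "real^3 \<Rightarrow> real"
  assumes u: "L-lipschitz_on UNIV u" and bs: "bounded {x. u x \<noteq> 0}"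
    and d: "AE x in lebesgue. u differentiable (at x)"
  shows "integrable lebesgue (grad u)"
proof -
  have "integrable lebesgue (\<lambda>x. \<Sum>i\<in>UNIV. partial u (axis i 1) x *\<^sub>R axis i (1::real))"
    using integral_partial_lipschitz(1)[OF u bs d] by (intro Bochner_Integration.integrable_sum integrable_scaleR_left)
  moreover have "(\<lambda>x. \<Sum>i\<in>UNIV. partial u (axis i 1) x *\<^sub>R axis i (1::real)) = grad u"
  proof
    show "(\<Sum>i\<in>UNIV. partial u (axis i 1) x *\<^sub>R axis i (1::real)) = grad u x" for x
      using basis_expansion[of "grad u x"] unfolding scalar_mult_eq_scaleR by (simp add: grad_def)
  qed
  ultimately show ?thesis by simp
qed

text \<open>
  Apply \<open>integral_partial_lipschitz\<close> to the product of \<open>u\<close> with a test function, which is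
  again Lipschitz with bounded support, and use the product rule almost everywhere.
\<close>

lemma has_weak_gradient_grad:
  fixes u :: "real^3 \<Rightarrow> real"
  assumes u: "L-lipschitz_on UNIV u" and bs: "bounded {x. u x \<noteq> 0}"
    and d: "AE x in lebesgue. u differentiable (at x)" and U: "open U"
  shows "has_weak_gradient U u (grad u)"
  unfolding has_weak_gradient_def
proof (intro conjI allI impI ballI)
  have uc: "continuous_on UNIV u" using u lipschitz_on_continuous_on by blast
  have ui: "integrable lebesgue u"
    by (rule integrable_lebesgue_continuous_compact_support[OF uc, of "closure {x. u x \<noteq> 0}"])
      (use bs closure_subset[of "{x. u x \<noteq> 0}"] in auto)
  note gi = integrable_grad_lipschitz[OF u bs d]
  fix K :: "(real^3) set" assume "compact K \<and> K \<subseteq> U"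
  then have "K \<in> sets lebesgue" by (simp add: lmeasurable_compact fmeasurableD)
  then show "u absolutely_integrable_on K" "grad u absolutely_integrable_on K"
    using ui gi by (simp_all add: absolutely_integrable_if_integrable)
next
  fix \<phi> i assume \<phi>: "\<phi> \<in> test_functions U"
  note T = test_functionD[OF \<phi>]
  obtain M where M: "M-lipschitz_on UNIV \<phi>" using T(8) by blast
  obtain A where A: "0 \<le> A" "\<And>x. \<bar>u x\<bar> \<le> A" using lipschitz_bounded_support_bounded[OF u bs] by blast
  obtain B where B: "0 \<le> B" "\<And>x. \<bar>\<phi> x\<bar> \<le> B" using lipschitz_bounded_support_bounded[OF M T(5)] by blast
  let ?e = "axis i 1 :: real^3"
  have PL: "(A * M + B * L)-lipschitz_on UNIV (\<lambda>x. u x * \<phi> x)"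
    by (rule lipschitz_on_mult_bounded[OF u M A(2) B(2)])
  have Pb: "bounded {x. u x * \<phi> x \<noteq> 0}" by (rule bounded_subset[OF bs]) auto
  have Pd: "AE x in lebesgue. (\<lambda>x. u x * \<phi> x) differentiable (at x)"
    using d by eventually_elim (intro differentiable_mult T(1))
  have eq: "AE x in lebesgue. partial (\<lambda>x. u x * \<phi> x) ?e x = u x * partial \<phi> ?e x + grad u x $ i * \<phi> x"
    using d
  proof eventually_elim
    case (elim x)
    then show ?case
      using has_derivative_mult[OF elim[unfolded frechet_derivative_works] T(1)[unfolded frechet_derivative_works]]
      by (subst partial_has_derivative) (auto simp: grad_def)
  qed
  have Uc: "U \<in> sets lebesgue" using U by (simp add: lborelD)
  have cl: "closure {x. \<phi> x \<noteq> 0} \<subseteq> U" by (rule T(7))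
  have z1: "u x * partial \<phi> ?e x = 0" if "x \<notin> U" for x
    using that cl partial_zero_off_support[of x \<phi> ?e] by auto
  have z2: "grad u x $ i * \<phi> x = 0" if "x \<notin> U" for x
    using that cl closure_subset[of "{x. \<phi> x \<noteq> 0}"] by auto
  have cc: "continuous_on UNIV (\<lambda>x. u x * partial \<phi> ?e x)"
    using u T(3) lipschitz_on_continuous_on by (intro continuous_intros) blast+
  then have i1: "integrable lebesgue (\<lambda>x. u x * partial \<phi> ?e x)"
    by (rule integrable_lebesgue_continuous_compact_support[OF _ T(6)]) (simp add: partial_zero_off_support)
  have i0: "integrable lebesgue (\<lambda>x. partial (\<lambda>x. u x * \<phi> x) ?e x - u x * partial \<phi> ?e x)"
    using integral_partial_lipschitz(1)[OF PL Pb Pd] i1 by (rule Bochner_Integration.integrable_diff)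
  have "(LINT x|lebesgue. grad u x $ i * \<phi> x) =
      (LINT x|lebesgue. partial (\<lambda>x. u x * \<phi> x) ?e x - u x * partial \<phi> ?e x)"
  proof (rule integral_cong_AE)
    have "(\<lambda>x. grad u x $ i) \<in> borel_measurable lebesgue"
      using integral_partial_lipschitz(1)[OF u bs d, of ?e] by (simp add: grad_def)
    moreover have "\<phi> \<in> borel_measurable lebesgue"
      using borel_measurable_continuous_onI[OF T(2)] by (simp add: measurable_completion)
    ultimately show "(\<lambda>x. grad u x $ i * \<phi> x) \<in> borel_measurable lebesgue"
      by (rule borel_measurable_times)
    show "AE x in lebesgue. grad u x $ i * \<phi> x = partial (\<lambda>x. u x * \<phi> x) ?e x - u x * partial \<phi> ?e x"
      using eq by eventually_elim simp
  qed (use i0 in simp)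
  also have "\<dots> = - (LINT x|lebesgue. u x * partial \<phi> ?e x)"
    using integral_partial_lipschitz[OF PL Pb Pd] i1 by simp
  finally show "(LINT x|lebesgue_on U. u x * partial \<phi> ?e x) = - (LINT x|lebesgue_on U. grad u x $ i * \<phi> x)"
    using integral_lebesgue_on_eq[OF Uc, of "\<lambda>x. u x * partial \<phi> ?e x"]
      integral_lebesgue_on_eq[OF Uc, of "\<lambda>x. grad u x $ i * \<phi> x"] z1 z2 by simp
qed

section \<open>Uniqueness of the weak gradient\<close>

text \<open>
  The functions are mollifications of the distance cutoffs \<open>max 0 (1 - k * infdist x C)\<close>. Their
  Lipschitz constant is \<open>k\<close>, so the mollification radius \<open>1 / k\<^sup>2\<close> makes the error
  \<open>1 / k\<close>, and the supports shrink towards \<open>C\<close>.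
\<close>

lemma compact_indicator_test_functions:
  assumes C: "compact C" "C \<noteq> {}" and U: "open U" "C \<subseteq> U"
  obtains K \<phi> where "compact K" "K \<subseteq> U" "C \<subseteq> K" "\<And>n::nat. \<phi> n \<in> test_functions U"
    "\<And>n x. x \<notin> K \<Longrightarrow> \<phi> n x = 0" "\<And>n x. \<bar>\<phi> n x\<bar> \<le> 2" "\<And>x. (\<lambda>n. \<phi> n x) \<longlonglongrightarrow> indicator C x"
proof -
  obtain e where e: "e > 0" "{x. infdist x C \<le> e} \<subseteq> U"
    using compact_in_open_separated[OF C(2,1) U] by blast
  define K where "K = {x. infdist x C \<le> e}"
  have K: "compact K" unfolding K_def by (rule compact_infdist_le[OF C(2,1) e(1)])
  \<comment> \<open>The shift by \<open>N\<close> keeps all supports, after mollification, within distance \<open>e\<close> of \<open>C\<close>.\<close>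
  obtain N where N: "2 / e < real N" using reals_Archimedean2 by blast
  define k where "k n = real (n + N + 1)" for n
  have k: "0 < k n" "1 \<le> k n" "1 / k n + 1 / (k n)\<^sup>2 \<le> e" for n
  proof -
    show *: "1 \<le> k n" by (simp add: k_def)
    then show k0: "0 < k n" by linarith
    have "1 / (k n)\<^sup>2 \<le> 1 / k n" using * k0 self_le_power[of "k n" 2] by (intro divide_left_mono) auto
    moreover have "2 / e \<le> k n" using N by (simp add: k_def)
    then have "2 / k n \<le> e" using e(1) k0 by (simp add: field_simps)
    ultimately show "1 / k n + 1 / (k n)\<^sup>2 \<le> e" by simp
  qed
  define f where "f n x = max 0 (1 - k n * infdist x C)" for n x
  have inf: "\<bar>infdist x C - infdist y C\<bar> \<le> dist x y" for x y :: "real^3"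
    using infdist_triangle[of x C y] infdist_triangle[of y C x] by (auto simp: dist_commute)
  have fL: "(k n)-lipschitz_on UNIV (f n)" for n
  proof (rule lipschitz_onI)
    fix x y
    have "\<bar>f n x - f n y\<bar> \<le> \<bar>k n * infdist x C - k n * infdist y C\<bar>"
      by (auto simp: f_def max_def)
    also have "\<dots> = k n * \<bar>infdist x C - infdist y C\<bar>"
      using k(1)[of n] by (simp add: abs_mult right_diff_distrib[symmetric])
    also have "\<dots> \<le> k n * dist x y" using inf k(1)[of n] by (intro mult_left_mono) auto
    finally show "dist (f n x) (f n y) \<le> k n * dist x y" by (simp add: dist_real_def)
  qed (use k(1)[of n] in simp)
  have fs: "infdist x C < 1 / k n" if "f n x \<noteq> 0" for n x
    using that k(1)[of n] by (auto simp: f_def max_def field_simps split: if_splits)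
  have fK: "{x. f n x \<noteq> 0} \<subseteq> K" for n
  proof
    fix x assume "x \<in> {x. f n x \<noteq> 0}"
    then have "infdist x C < 1 / k n" using fs by blast
    moreover have "1 / (k n)\<^sup>2 > 0" using k(1)[of n] by simp
    ultimately have "infdist x C \<le> e" using k(3)[of n] by linarith
    then show "x \<in> K" unfolding K_def by blast
  qed
  then have fb: "bounded {x. f n x \<noteq> 0}" for n using K by (meson bounded_subset compact_imp_bounded)
  have "\<exists>\<phi>. (\<forall>k. Ck k \<phi>) \<and> (\<forall>x. \<bar>\<phi> x - f n x\<bar> \<le> 1 / k n) \<and> (\<forall>x. \<phi> x \<noteq> 0 \<longrightarrow> x \<in> K)" for n
  proof -
    have "0 < 1 / (k n)\<^sup>2" using k(1)[of n] by simp
    from mollify[OF fL fb this]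
    obtain \<phi> where \<phi>: "\<And>k. Ck k \<phi>" "\<And>x. \<bar>\<phi> x - f n x\<bar> \<le> k n * (1 / (k n)\<^sup>2)"
      "\<And>x. \<phi> x \<noteq> 0 \<Longrightarrow> \<exists>y. f n y \<noteq> 0 \<and> dist x y < 1 / (k n)\<^sup>2" by metis
    have "x \<in> K" if nz: "\<phi> x \<noteq> 0" for x
    proof -
      obtain y where "f n y \<noteq> 0" "dist x y < 1 / (k n)\<^sup>2" using \<phi>(3)[OF nz] by blast
      then show ?thesis using fs[of n y] infdist_triangle[of x C y] k(3)[of n] unfolding K_def by auto
    qed
    moreover have "\<bar>\<phi> x - f n x\<bar> \<le> 1 / k n" for x
      using \<phi>(2)[of x] k(1)[of n] by (simp add: power2_eq_square)
    ultimately show ?thesis using \<phi>(1) by blast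
  qed
  then obtain \<phi> where \<phi>: "\<And>n k. Ck k (\<phi> n)" "\<And>n x. \<bar>\<phi> n x - f n x\<bar> \<le> 1 / k n"
    "\<And>n x. \<phi> n x \<noteq> 0 \<Longrightarrow> x \<in> K" by metis
  show ?thesis
  proof (rule that[of K \<phi>])
    show "compact K" "K \<subseteq> U" "C \<subseteq> K" using K e by (auto simp: K_def)
    show "\<phi> n \<in> test_functions U" for n
    proof -
      have "closure {x. \<phi> n x \<noteq> 0} \<subseteq> K"
        using \<phi>(3) K by (intro closure_minimal) (auto simp: compact_imp_closed)
      moreover have "compact (closure {x. \<phi> n x \<noteq> 0})"
        using \<phi>(3) K by (auto intro: bounded_subset[OF compact_imp_bounded[OF K]])
      ultimately show ?thesis
        using \<phi>(1) e(2) by (auto simp: test_functions_def K_def)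
    qed
    show "\<phi> n x = 0" if "x \<notin> K" for n x using \<phi>(3) that by blast
    show "\<bar>\<phi> n x\<bar> \<le> 2" for n x
    proof -
      have "0 \<le> f n x" "f n x \<le> 1" using k(1)[of n] infdist_nonneg[of x C] by (auto simp: f_def)
      moreover have "1 / k n \<le> 1" using k[of n] by simp
      ultimately show ?thesis using \<phi>(2)[of n x] by linarith
    qed
    show "(\<lambda>n. \<phi> n x) \<longlonglongrightarrow> indicator C x" for x
    proof -
      have klim: "filterlim k at_top sequentially"
        by (rule filterlim_at_top_mono[OF filterlim_real_sequentially]) (simp add: k_def)
      have "(\<lambda>n. 1 / k n) \<longlonglongrightarrow> 0"
        by (rule real_tendsto_divide_at_top[OF tendsto_const klim])
      then have "(\<lambda>n. \<phi> n x - f n x) \<longlonglongrightarrow> 0"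
        by (rule Lim_null_comparison[rotated]) (simp add: \<phi>(2))
      moreover have "(\<lambda>n. f n x) \<longlonglongrightarrow> indicator C x"
      proof (cases "x \<in> C")
        case False
        then have d: "infdist x C > 0"
          using C in_closed_iff_infdist_zero[of C x] infdist_nonneg[of x C] by (auto simp: compact_imp_closed order_less_le)
        have "eventually (\<lambda>n. 1 / infdist x C \<le> k n) sequentially"
          using klim by (simp add: filterlim_at_top)
        then have "eventually (\<lambda>n. f n x = 0) sequentially"
          by eventually_elim (use d in \<open>auto simp: f_def field_simps max_def\<close>)
        then show ?thesis using False by (simp add: tendsto_eventually)
      qed (simp add: f_def)
      ultimately have "(\<lambda>n. (\<phi> n x - f n x) + f n x) \<longlonglongrightarrow> 0 + indicator C x" by (rule tendsto_add)
      then show ?thesis by simp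
    qed
  qed
qed

text \<open>
  Inner regularity of Lebesgue measure by closed sets, which are countable unions of compact sets.
\<close>

lemma negligible_if_compact_subsets_negligible:
  fixes S :: "'a::euclidean_space set"
  assumes S: "S \<in> sets lebesgue" and C: "\<And>C. compact C \<Longrightarrow> C \<subseteq> S \<Longrightarrow> negligible C"
  shows "negligible S"
proof -
  have "emeasure lebesgue S \<le> 0 + ennreal e" if e: "e > 0" for e :: real
  proof -
    obtain T where T: "closed T" "T \<subseteq> S" "S - T \<in> lmeasurable" "emeasure lebesgue (S - T) < ennreal e"
      using sets_lebesgue_inner_closed[OF S e] by blast
    have "negligible (T \<inter> cball 0 (real n))" for n
      using T(1,2) by (intro C closed_Int_compact compact_cball) auto
    then have "negligible (\<Union>n::nat. T \<inter> cball 0 (real n))"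
      by (intro negligible_countable_Union) auto
    moreover have "(\<Union>n::nat. T \<inter> cball 0 (real n)) = T"
      using real_arch_simple by auto
    ultimately have "T \<in> null_sets lebesgue" by (simp add: negligible_iff_null_sets)
    moreover have "S = (S - T) \<union> T" using T by auto
    ultimately have "emeasure lebesgue S = emeasure lebesgue (S - T)"
      using emeasure_Un_null_set[OF fmeasurableD[OF T(3)]] by metis
    then show ?thesis using T(4) less_imp_le by simp
  qed
  then have "emeasure lebesgue S \<le> 0" by (rule ennreal_le_epsilon)
  then have "S \<in> null_sets lebesgue" using S by (intro null_setsI) auto
  then show ?thesis unfolding negligible_iff_null_sets .
qed

lemma integral_compact_eq_0:
  fixes q :: "real^3 \<Rightarrow> real"
  assumes U: "open U" and q: "\<And>K. compact K \<Longrightarrow> K \<subseteq> U \<Longrightarrow> q absolutely_integrable_on K"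
    and z: "\<And>\<phi>. \<phi> \<in> test_functions U \<Longrightarrow> (LINT x|lebesgue_on U. q x * \<phi> x) = 0"
    and C: "compact C" "C \<subseteq> U"
  shows "(LINT x|lebesgue. indicator C x * q x) = 0"
proof (cases "C = {}")
  case False
  have Um: "U \<in> sets lebesgue" using U by (simp add: lborelD)
  obtain K \<phi> where K: "compact K" "K \<subseteq> U" "C \<subseteq> K" and \<phi>: "\<And>n::nat. \<phi> n \<in> test_functions U"
    "\<And>n x. x \<notin> K \<Longrightarrow> \<phi> n x = 0" "\<And>n x. \<bar>\<phi> n x\<bar> \<le> 2" "\<And>x. (\<lambda>n. \<phi> n x) \<longlonglongrightarrow> indicator C x"
    using compact_indicator_test_functions[OF C(1) False U C(2)] by metis
  define Q where "Q x = indicator K x * q x" for x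
  have Q: "integrable lebesgue Q"
    using q[OF K(1,2)] by (simp add: Q_def[abs_def] set_integrable_def)
  have Cm: "C \<in> sets lebesgue" using C by (simp add: lmeasurable_compact fmeasurableD)
  have \<phi>m: "\<phi> n \<in> borel_measurable lebesgue" for n
    using borel_measurable_continuous_onI[OF test_functionD(2)[OF \<phi>(1)]] by (simp add: measurable_completion)
  have "(\<lambda>n. LINT x|lebesgue. Q x * \<phi> n x) \<longlonglongrightarrow> (LINT x|lebesgue. Q x * indicator C x)"
  proof (rule integral_dominated_convergence[where w="\<lambda>x. \<bar>Q x\<bar> * 2"])
    show "(\<lambda>x. Q x * indicator C x) \<in> borel_measurable lebesgue" "(\<lambda>x. Q x * \<phi> n x) \<in> borel_measurable lebesgue" for n
      using Q Cm \<phi>m by auto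
    show "integrable lebesgue (\<lambda>x. \<bar>Q x\<bar> * 2)" using Q by simp
    show "AE x in lebesgue. (\<lambda>n. Q x * \<phi> n x) \<longlonglongrightarrow> Q x * indicator C x"
      by (intro AE_I2 tendsto_intros \<phi>)
    show "AE x in lebesgue. norm (Q x * \<phi> n x) \<le> \<bar>Q x\<bar> * 2" for n
      using \<phi>(3)[of n] by (intro AE_I2) (auto simp: abs_mult intro!: mult_left_mono)
  qed
  moreover have "(LINT x|lebesgue. Q x * \<phi> n x) = 0" for n
  proof -
    have "(\<lambda>x. Q x * \<phi> n x) = (\<lambda>x. q x * \<phi> n x)"
      using \<phi>(2) by (auto simp: Q_def indicator_def fun_eq_iff)
    moreover have "(LINT x|lebesgue_on U. q x * \<phi> n x) = (LINT x|lebesgue. q x * \<phi> n x)"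
      using \<phi>(2) K by (intro integral_lebesgue_on_eq[OF Um]) auto
    ultimately show ?thesis using z[OF \<phi>(1)] by simp
  qed
  moreover have "Q x * indicator C x = indicator C x * q x" for x
    using K(3) by (auto simp: Q_def indicator_def)
  ultimately show ?thesis by (simp add: LIMSEQ_const_iff)
qed simp

text \<open>
  The fundamental lemma of the calculus of variations, one sign at a time: a compact subset \<open>C\<close> of
  the positivity set satisfies \<open>\<integral>\<^sub>C q = 0\<close> with \<open>q > 0\<close> on \<open>C\<close>, hence is null.
\<close>

lemma negligible_positive_part:
  fixes q :: "real^3 \<Rightarrow> real"
  assumes U: "open U" and q: "\<And>K. compact K \<Longrightarrow> K \<subseteq> U \<Longrightarrow> q absolutely_integrable_on K"
    and z: "\<And>\<phi>. \<phi> \<in> test_functions U \<Longrightarrow> (LINT x|lebesgue_on U. q x * \<phi> x) = 0"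
  shows "negligible {x \<in> U. q x > 0}"
proof -
  have *: "negligible {x \<in> K. q x > 0}" if K: "compact K" "K \<subseteq> U" for K
  proof (rule negligible_if_compact_subsets_negligible)
    have "(\<lambda>x. indicator K x * q x) \<in> borel_measurable lebesgue"
      using q[OF K] by (simp add: set_integrable_def)
    then have "{x \<in> space lebesgue. indicator K x * q x > 0} \<in> sets lebesgue" by measurable
    moreover have "{x \<in> space lebesgue. indicator K x * q x > 0} = {x \<in> K. q x > 0}"
      by (auto simp: indicator_def split: if_splits)
    ultimately show "{x \<in> K. q x > 0} \<in> sets lebesgue" by simp
    fix C assume C: "compact C" "C \<subseteq> {x \<in> K. q x > 0}"
    then have CU: "C \<subseteq> U" using K by auto
    have "integrable lebesgue (\<lambda>x. indicator C x * q x)"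
      using q[OF C(1) CU] by (simp add: set_integrable_def)
    moreover have "(LINT x|lebesgue. indicator C x * q x) = 0"
      by (rule integral_compact_eq_0[OF U _ _ C(1) CU]) (fact q, fact z)
    ultimately have "AE x in lebesgue. indicator C x * q x = 0"
      using C(2)
      by (subst (asm) integral_nonneg_eq_0_iff_AE) (auto simp: indicator_def intro!: AE_I2 less_imp_le)
    then have "AE x in lebesgue. x \<notin> C"
      by eventually_elim (use C(2) in \<open>auto simp: indicator_def split: if_splits\<close>)
    then show "negligible C"
      using C(1) AE_iff_null_sets[of C lebesgue]
      by (simp add: negligible_iff_null_sets lmeasurable_compact fmeasurableD)
  qed
  obtain D where D: "countable D" "D \<subseteq> Pow U" "\<And>X. X \<in> D \<Longrightarrow> \<exists>a b. X = cbox a b" "\<Union>D = U"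
    using open_countable_Union_open_cbox[OF U] by metis
  have "negligible {x \<in> X. q x > 0}" if "X \<in> D" for X
  proof (rule *)
    show "compact X" using D(3)[OF that] by auto
    show "X \<subseteq> U" using D(2) that by auto
  qed
  then have "negligible (\<Union>X\<in>D. {x \<in> X. q x > 0})"
    using D(1) by (intro negligible_countable_Union) auto
  moreover have "(\<Union>X\<in>D. {x \<in> X. q x > 0}) = {x \<in> U. q x > 0}" using D(4) by auto
  ultimately show ?thesis by simp
qed

lemma integrable_times_test_function:
  fixes q :: "real^3 \<Rightarrow> real"
  assumes U: "open U" and q: "\<And>K. compact K \<Longrightarrow> K \<subseteq> U \<Longrightarrow> q absolutely_integrable_on K"
    and \<psi>: "continuous_on UNIV \<psi>" "compact S" "S \<subseteq> U" "\<And>x. x \<notin> S \<Longrightarrow> \<psi> x = 0"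
  shows "integrable (lebesgue_on U) (\<lambda>x. q x * \<psi> x)"
proof -
  have Um: "U \<in> sets lebesgue" using U by (simp add: lborelD)
  have Sm: "S \<in> sets lebesgue" using \<psi> by (simp add: lmeasurable_compact fmeasurableD)
  have "bounded (\<psi> ` S)"
    using \<psi> by (intro compact_imp_bounded compact_continuous_image) (auto intro: continuous_on_subset)
  then obtain B where B: "\<And>x. x \<in> S \<Longrightarrow> \<bar>\<psi> x\<bar> \<le> B" unfolding bounded_iff by auto
  have Q: "integrable lebesgue (\<lambda>x. indicator S x * q x)"
    using q[OF \<psi>(2,3)] by (simp add: set_integrable_def)
  have "integrable lebesgue (\<lambda>x. (indicator S x * q x) * \<psi> x)"
  proof (rule Bochner_Integration.integrable_bound)
    show "integrable lebesgue (\<lambda>x. B * \<bar>indicator S x * q x\<bar>)" using Q by simp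
    show "(\<lambda>x. (indicator S x * q x) * \<psi> x) \<in> borel_measurable lebesgue"
      using borel_measurable_continuous_onI[OF \<psi>(1)]
      by (intro borel_measurable_times borel_measurable_integrable[OF Q]) (auto simp: measurable_completion)
    show "AE x in lebesgue. norm ((indicator S x * q x) * \<psi> x) \<le> norm (B * \<bar>indicator S x * q x\<bar>)"
    proof (rule AE_I2)
      fix x
      have "\<bar>q x\<bar> * \<bar>\<psi> x\<bar> \<le> \<bar>B\<bar> * \<bar>q x\<bar>" if "x \<in> S"
        using B[OF that] mult_left_mono[of "\<bar>\<psi> x\<bar>" "\<bar>B\<bar>" "\<bar>q x\<bar>"] by (simp add: mult.commute)
      then show "norm ((indicator S x * q x) * \<psi> x) \<le> norm (B * \<bar>indicator S x * q x\<bar>)"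
        by (simp add: indicator_def abs_mult)
    qed
  qed
  moreover have "(\<lambda>x. (indicator S x * q x) * \<psi> x) = (\<lambda>x. indicator U x *\<^sub>R (q x * \<psi> x))"
    using \<psi>(3,4) by (auto simp: indicator_def fun_eq_iff)
  ultimately show ?thesis using Um by (simp add: integrable_restrict_space)
qed

lemma has_weak_gradientD:
  assumes "has_weak_gradient U u p"
  shows "\<And>K. compact K \<Longrightarrow> K \<subseteq> U \<Longrightarrow> u absolutely_integrable_on K"
    "\<And>K. compact K \<Longrightarrow> K \<subseteq> U \<Longrightarrow> p absolutely_integrable_on K"
    "\<And>K i. compact K \<Longrightarrow> K \<subseteq> U \<Longrightarrow> (\<lambda>x. p x $ i) absolutely_integrable_on K"
    "\<And>\<phi> i. \<phi> \<in> test_functions U \<Longrightarrow> (LINT x|lebesgue_on U. u x * partial \<phi> (axis i 1) x) =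
        - (LINT x|lebesgue_on U. p x $ i * \<phi> x)"
proof -
  show 1: "u absolutely_integrable_on K" "p absolutely_integrable_on K" if "compact K" "K \<subseteq> U" for K
    using assms that unfolding has_weak_gradient_def by auto
  show "(\<lambda>x. p x $ i) absolutely_integrable_on K" if "compact K" "K \<subseteq> U" for K i
    using absolutely_integrable_component[OF 1(2)[OF that], of "axis i 1"] by (simp add: inner_axis)
  show "(LINT x|lebesgue_on U. u x * partial \<phi> (axis i 1) x) = - (LINT x|lebesgue_on U. p x $ i * \<phi> x)"
    if "\<phi> \<in> test_functions U" for \<phi> i
    using assms that unfolding has_weak_gradient_def by auto
qed

lemma has_weak_gradient_diff:
  assumes U: "open U" and u: "has_weak_gradient U u p" and v: "has_weak_gradient U v q"
  shows "has_weak_gradient U (\<lambda>x. u x - v x) (\<lambda>x. p x - q x)"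
  unfolding has_weak_gradient_def
proof (intro conjI allI impI ballI)
  note u = has_weak_gradientD[OF u] and v = has_weak_gradientD[OF v]
  fix K assume "compact K \<and> K \<subseteq> U"
  then show "(\<lambda>x. u x - v x) absolutely_integrable_on K" "(\<lambda>x. p x - q x) absolutely_integrable_on K"
    using u v by (auto intro!: set_integral_diff(1))
next
  note u = has_weak_gradientD[OF u] and v = has_weak_gradientD[OF v]
  fix \<phi> i assume \<phi>: "\<phi> \<in> test_functions U"
  note T = test_functionD[OF \<phi>]
  let ?d = "partial \<phi> (axis i 1)"
  have "\<phi> x = 0" if "x \<notin> closure {x. \<phi> x \<noteq> 0}" for x
    using that closure_subset[of "{x. \<phi> x \<noteq> 0}"] by auto
  note iP = integrable_times_test_function[OF U _ T(2,6,7) this]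
  note iD = integrable_times_test_function[OF U _ T(3,6,7) partial_zero_off_support]
  show "(LINT x|lebesgue_on U. (u x - v x) * ?d x) = - (LINT x|lebesgue_on U. (p x - q x) $ i * \<phi> x)"
    using iP[OF u(3)] iP[OF v(3)] iD[OF u(1)] iD[OF v(1)] u(4)[OF \<phi>] v(4)[OF \<phi>]
    by (simp add: left_diff_distrib)
qed

lemma weak_gradient_unique:
  assumes U: "open U" and p: "has_weak_gradient U u p" and q: "has_weak_gradient U u q"
  shows "AE x in lebesgue_on U. p x = q x"
proof -
  have *: "negligible {x \<in> U. p x $ i - q x $ i > 0}"
    if "has_weak_gradient U u p" "has_weak_gradient U u q" for p q i
  proof -
    note D = has_weak_gradientD[OF has_weak_gradient_diff[OF U that]]
    show ?thesis
    proof (rule negligible_positive_part[OF U])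
      show "(\<lambda>x. p x $ i - q x $ i) absolutely_integrable_on K" if "compact K" "K \<subseteq> U" for K
        using D(3)[OF that, of i] by simp
      show "(LINT x|lebesgue_on U. (p x $ i - q x $ i) * \<phi> x) = 0" if "\<phi> \<in> test_functions U" for \<phi>
        using D(4)[OF that, of i] by simp
    qed
  qed
  have n: "negligible (\<Union>i. {x \<in> U. p x $ i - q x $ i > 0} \<union> {x \<in> U. q x $ i - p x $ i > 0})"
    using *[OF p q] *[OF q p] by (intro negligible_countable_Union) (auto intro!: negligible_Un)
  have Um: "U \<in> sets lebesgue" using U by (simp add: lborelD)
  have "AE x in lebesgue. x \<notin> (\<Union>i. {x \<in> U. p x $ i - q x $ i > 0} \<union> {x \<in> U. q x $ i - p x $ i > 0})"
    using n unfolding negligible_iff_null_sets by (rule AE_not_in)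
  then have "AE x in lebesgue. x \<in> U \<longrightarrow> p x = q x"
  proof eventually_elim
    case (elim x)
    show ?case
    proof
      assume "x \<in> U"
      then have "\<not> p x $ i - q x $ i > 0" "\<not> q x $ i - p x $ i > 0" for i using elim by auto
      then show "p x = q x" by (simp add: vec_eq_iff) (meson linorder_neqE_linordered_idom)
    qed
  qed
  then show ?thesis using Um by (simp add: AE_restrict_space_iff)
qed

lemma weak_gradient_eq:
  assumes U: "open U" and p: "has_weak_gradient U u p"
  shows "has_weak_gradient U u (weak_gradient U u)" "AE x in lebesgue_on U. weak_gradient U u x = p x"
proof -
  show "has_weak_gradient U u (weak_gradient U u)"
    unfolding weak_gradient_def using p by (rule someI[where P="has_weak_gradient U u"])
  from weak_gradient_unique[OF U this p] show "AE x in lebesgue_on U. weak_gradient U u x = p x" .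
qed

section \<open>Square-integrable functions and the energy space\<close>

text \<open>
  The exponent is written \<open>ereal 2\<close> because the simplifier puts the numeral \<open>2\<close> of type
  \<open>ereal\<close> into this form.
\<close>

lemma Lp_2_iff:
  "f \<in> Lp (ereal 2) U \<longleftrightarrow> f \<in> borel_measurable (lebesgue_on U) \<and> integrable (lebesgue_on U) (\<lambda>x. (norm (f x))\<^sup>2)"
  by (simp add: Lp_def)

lemma Lp_norm_2: "Lp_norm (ereal 2) U f = sqrt (LINT x|lebesgue_on U. (norm (f x))\<^sup>2)"
  by (simp add: Lp_norm_def powr_half_sqrt)

lemma Lp_2_diff:
  fixes f g :: "real^3 \<Rightarrow> 'b::euclidean_space"
  assumes f: "f \<in> Lp 2 U" and g: "g \<in> Lp 2 U"
  shows "(\<lambda>x. f x - g x) \<in> Lp 2 U"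
proof -
  have m: "(\<lambda>x. f x - g x) \<in> borel_measurable (lebesgue_on U)"
    using f g by (auto simp: Lp_2_iff)
  have "integrable (lebesgue_on U) (\<lambda>x. (norm (f x - g x))\<^sup>2)"
  proof (rule Bochner_Integration.integrable_bound)
    show "integrable (lebesgue_on U) (\<lambda>x. 2 * (norm (f x))\<^sup>2 + 2 * (norm (g x))\<^sup>2)"
      using f g by (simp add: Lp_2_iff)
    show "AE x in lebesgue_on U. norm ((norm (f x - g x))\<^sup>2) \<le> norm (2 * (norm (f x))\<^sup>2 + 2 * (norm (g x))\<^sup>2)"
    proof (rule AE_I2)
      fix x
      have "(norm (f x - g x))\<^sup>2 \<le> (norm (f x) + norm (g x))\<^sup>2"
        by (intro power_mono norm_triangle_ineq4) auto
      also have "\<dots> \<le> 2 * (norm (f x))\<^sup>2 + 2 * (norm (g x))\<^sup>2"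
        using sum_squares_bound[of "norm (f x)" "norm (g x)"] by (simp add: power2_sum)
      finally show "norm ((norm (f x - g x))\<^sup>2) \<le> norm (2 * (norm (f x))\<^sup>2 + 2 * (norm (g x))\<^sup>2)" by simp
    qed
  qed (use m in measurable)
  then show ?thesis using m by (simp add: Lp_2_iff)
qed

lemma Lp_2_AE:
  fixes f g :: "real^3 \<Rightarrow> 'b::euclidean_space"
  assumes U: "U \<in> sets lebesgue" and f: "f \<in> Lp 2 U" and ae: "AE x in lebesgue_on U. f x = g x"
  shows "g \<in> Lp 2 U" "(LINT x|lebesgue_on U. (norm (f x))\<^sup>2) = (LINT x|lebesgue_on U. (norm (g x))\<^sup>2)"
proof -
  have fm: "f \<in> borel_measurable (lebesgue_on U)" and fi: "integrable (lebesgue_on U) (\<lambda>x. (norm (f x))\<^sup>2)"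
    using f by (auto simp: Lp_2_iff)
  have "(\<lambda>x. if x \<in> U then f x else 0) \<in> borel_measurable lebesgue"
    using fm U by (simp add: borel_measurable_if)
  moreover have "AE x in lebesgue. (if x \<in> U then f x else 0) = (if x \<in> U then g x else 0)"
    using ae U by (simp add: AE_restrict_space_iff)
  ultimately have "(\<lambda>x. if x \<in> U then g x else 0) \<in> borel_measurable lebesgue" by (rule borel_measurable_AE)
  then have gm: "g \<in> borel_measurable (lebesgue_on U)" using U by (simp add: borel_measurable_if)
  have ae2: "AE x in lebesgue_on U. (norm (f x))\<^sup>2 = (norm (g x))\<^sup>2"
    using ae by eventually_elim simp
  have "integrable (lebesgue_on U) (\<lambda>x. (norm (g x))\<^sup>2)"
    by (rule integrable_cong_AE_imp[OF fi _ ]) (use gm ae2 in \<open>auto elim: eventually_mono\<close>)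
  then show "g \<in> Lp 2 U" using gm by (simp add: Lp_2_iff)
  show "(LINT x|lebesgue_on U. (norm (f x))\<^sup>2) = (LINT x|lebesgue_on U. (norm (g x))\<^sup>2)"
    by (rule integral_cong_AE) (use fm gm ae2 in auto)
qed

lemma borel_measurable_vec_component:
  fixes p :: "'a \<Rightarrow> real^'n::finite"
  assumes "p \<in> borel_measurable M" shows "(\<lambda>x. p x $ i) \<in> borel_measurable M"
proof -
  have "(\<lambda>x. p x \<bullet> axis i 1) \<in> borel_measurable M" using assms by measurable
  then show ?thesis by (simp add: inner_axis)
qed

lemma integral_norm_sq_components:
  fixes p :: "real^3 \<Rightarrow> real^3"
  assumes "p \<in> Lp 2 U"
  shows "(\<Sum>i\<in>UNIV. LINT x|lebesgue_on U. (p x $ i)\<^sup>2) = (LINT x|lebesgue_on U. (norm (p x))\<^sup>2)"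
proof -
  have eq: "(norm (p x))\<^sup>2 = (\<Sum>i\<in>UNIV. (p x $ i)\<^sup>2)" for x
    unfolding power2_norm_eq_inner inner_vec_def by (simp add: power2_eq_square)
  have pm: "p \<in> borel_measurable (lebesgue_on U)" and pin: "integrable (lebesgue_on U) (\<lambda>x. (norm (p x))\<^sup>2)"
    using assms by (auto simp: Lp_2_iff)
  have "integrable (lebesgue_on U) (\<lambda>x. (p x $ i)\<^sup>2)" for i
  proof (rule Bochner_Integration.integrable_bound[OF pin])
    show "(\<lambda>x. (p x $ i)\<^sup>2) \<in> borel_measurable (lebesgue_on U)"
      using borel_measurable_vec_component[OF pm, of i] by measurable
    show "AE x in lebesgue_on U. norm ((p x $ i)\<^sup>2) \<le> norm ((norm (p x))\<^sup>2)"
      using component_le_norm_cart[of "p x" i for x] by (intro AE_I2) (simp add: abs_le_square_iff[symmetric])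
  qed
  then show ?thesis unfolding eq by (simp add: Bochner_Integration.integral_sum)
qed

text \<open>
  Any weak gradient may stand in for the chosen one, by uniqueness; this turns the norm of
  \<open>W1 2\<close> into an expression that can be computed.
\<close>

lemma W1_2I:
  assumes U: "open U" and u: "u \<in> Lp 2 U" and p: "has_weak_gradient U u p" "p \<in> Lp 2 U"
  shows "u \<in> W1 2 U" "W1_norm 2 U u = sqrt ((LINT x|lebesgue_on U. (u x)\<^sup>2) + (LINT x|lebesgue_on U. (norm (p x))\<^sup>2))"
proof -
  have Um: "U \<in> sets lebesgue" using U by (simp add: lborelD)
  have ae: "AE x in lebesgue_on U. p x = weak_gradient U u x"
    using weak_gradient_eq(2)[OF U p(1)] by eventually_elim simp
  note w = Lp_2_AE[OF Um p(2) ae]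
  show "u \<in> W1 2 U" using u p w by (auto simp: W1_def)
  have "W1_norm 2 U u = sqrt ((LINT x|lebesgue_on U. (u x)\<^sup>2) + (\<Sum>i\<in>UNIV. LINT x|lebesgue_on U. (weak_gradient U u x $ i)\<^sup>2))"
    by (simp add: W1_norm_def Lp_norm_2 powr_half_sqrt sum_nonneg)
  then show "W1_norm 2 U u = sqrt ((LINT x|lebesgue_on U. (u x)\<^sup>2) + (LINT x|lebesgue_on U. (norm (p x))\<^sup>2))"
    by (simp add: integral_norm_sq_components[OF w(1)] w(2))
qed

lemma Lp_2_continuous:
  fixes f :: "real^3 \<Rightarrow> 'b::euclidean_space"
  assumes c: "continuous_on UNIV f" and K: "compact K" "\<And>x. x \<notin> K \<Longrightarrow> f x = 0" and U: "U \<in> sets lebesgue"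
  shows "f \<in> Lp 2 U"
proof -
  have "continuous_on UNIV (\<lambda>x. (norm (f x))\<^sup>2)" using c by (intro continuous_intros)
  then have "integrable lebesgue (\<lambda>x. (norm (f x))\<^sup>2)"
    by (rule integrable_lebesgue_continuous_compact_support[OF _ K(1)]) (simp add: K)
  then have "integrable (lebesgue_on U) (\<lambda>x. (norm (f x))\<^sup>2)"
    using integrable_mult_indicator[OF U, of "\<lambda>x. (norm (f x))\<^sup>2"] U by (simp add: integrable_restrict_space)
  moreover have "f \<in> borel_measurable (lebesgue_on U)"
    using borel_measurable_continuous_onI[OF c] by (simp add: measurable_completion measurable_restrict_space1)
  ultimately show ?thesis by (simp add: Lp_2_iff)
qed

lemma test_function_Lp:
  assumes \<phi>: "\<phi> \<in> test_functions U" and U: "open U"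
  shows "\<phi> \<in> Lp 2 U" "grad \<phi> \<in> Lp 2 U" "has_weak_gradient U \<phi> (grad \<phi>)"
proof -
  note T = test_functionD[OF \<phi>]
  have Um: "U \<in> sets lebesgue" using U by (simp add: lborelD)
  show "\<phi> \<in> Lp 2 U"
    by (rule Lp_2_continuous[OF T(2,6) _ Um]) (use closure_subset[of "{x. \<phi> x \<noteq> 0}"] in auto)
  show "grad \<phi> \<in> Lp 2 U"
    by (rule Lp_2_continuous[OF T(4,6) grad_zero_off_support Um])
  obtain L where "L-lipschitz_on UNIV \<phi>" using T(8) by blast
  then show "has_weak_gradient U \<phi> (grad \<phi>)"
    using has_weak_gradient_grad[OF _ T(5) _ U] T(1) by auto
qed

lemma W1_2_diff_test_function:
  assumes U: "open U" and u: "u \<in> Lp 2 U" "has_weak_gradient U u p" "p \<in> Lp 2 U"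
    and \<phi>: "\<phi> \<in> test_functions U"
  shows "W1_norm 2 U (\<lambda>x. \<phi> x - u x) =
    sqrt ((LINT x|lebesgue_on U. (\<phi> x - u x)\<^sup>2) + (LINT x|lebesgue_on U. (norm (grad \<phi> x - p x))\<^sup>2))"
  by (rule W1_2I(2)[OF U Lp_2_diff has_weak_gradient_diff[OF U] Lp_2_diff])
    (use u test_function_Lp[OF \<phi> U] in auto)

lemma H10I:
  assumes U: "open U" and u: "u \<in> Lp 2 U" "has_weak_gradient U u p" "p \<in> Lp 2 U"
    and \<phi>: "\<And>n::nat. \<phi> n \<in> test_functions U"
    and l0: "(\<lambda>n. LINT x|lebesgue_on U. (\<phi> n x - u x)\<^sup>2) \<longlonglongrightarrow> 0"
    and l1: "(\<lambda>n. LINT x|lebesgue_on U. (norm (grad (\<phi> n) x - p x))\<^sup>2) \<longlonglongrightarrow> 0"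
  shows "u \<in> H10 U"
proof -
  have "(\<lambda>n. W1_norm 2 U (\<lambda>x. \<phi> n x - u x)) \<longlonglongrightarrow> sqrt (0 + 0)"
    unfolding W1_2_diff_test_function[OF U u \<phi>] by (intro tendsto_intros l0 l1)
  then show ?thesis using W1_2I(1)[OF U u] \<phi> by (auto simp: H10_def)
qed

lemma H10D:
  assumes U: "open U" and u: "u \<in> H10 U"
  shows "u \<in> Lp 2 U" "has_weak_gradient U u (weak_gradient U u)" "weak_gradient U u \<in> Lp 2 U"
    "\<exists>\<phi>. (\<forall>n::nat. \<phi> n \<in> test_functions U) \<and>
      (\<lambda>n. LINT x|lebesgue_on U. (\<phi> n x - u x)\<^sup>2) \<longlonglongrightarrow> 0 \<and>
      (\<lambda>n. LINT x|lebesgue_on U. (norm (grad (\<phi> n) x - weak_gradient U u x))\<^sup>2) \<longlonglongrightarrow> 0"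
proof -
  have W: "u \<in> W1 2 U" using u by (simp add: H10_def)
  show L: "u \<in> Lp 2 U" "weak_gradient U u \<in> Lp 2 U" using W by (auto simp: W1_def)
  show g: "has_weak_gradient U u (weak_gradient U u)"
    using W weak_gradient_eq(1)[OF U] by (auto simp: W1_def)
  obtain \<phi> where \<phi>: "\<And>n::nat. \<phi> n \<in> test_functions U"
    and lim: "(\<lambda>n. W1_norm 2 U (\<lambda>x. \<phi> n x - u x)) \<longlonglongrightarrow> 0"
    using u by (auto simp: H10_def)
  define a where "a n = (LINT x|lebesgue_on U. (\<phi> n x - u x)\<^sup>2)" for n
  define b where "b n = (LINT x|lebesgue_on U. (norm (grad (\<phi> n) x - weak_gradient U u x))\<^sup>2)" for n
  have nn: "0 \<le> a n" "0 \<le> b n" for n by (simp_all add: a_def b_def)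
  have "(\<lambda>n. (W1_norm 2 U (\<lambda>x. \<phi> n x - u x))\<^sup>2) \<longlonglongrightarrow> 0\<^sup>2" by (intro tendsto_power lim)
  then have "(\<lambda>n. a n + b n) \<longlonglongrightarrow> 0"
    unfolding W1_2_diff_test_function[OF U L(1) g L(2) \<phi>] a_def[symmetric] b_def[symmetric]
    using nn by simp
  then have "a \<longlonglongrightarrow> 0" "b \<longlonglongrightarrow> 0"
    by (rule tendsto_sandwich[OF _ _ tendsto_const, rotated -1]; simp add: nn)+
  then show "\<exists>\<phi>. (\<forall>n::nat. \<phi> n \<in> test_functions U) \<and>
      (\<lambda>n. LINT x|lebesgue_on U. (\<phi> n x - u x)\<^sup>2) \<longlonglongrightarrow> 0 \<and>
      (\<lambda>n. LINT x|lebesgue_on U. (norm (grad (\<phi> n) x - weak_gradient U u x))\<^sup>2) \<longlonglongrightarrow> 0"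
    using \<phi> unfolding a_def b_def by blast
qed

section \<open>A Poincare inequality on small balls\<close>

text \<open>
  The right-hand side is the divergence of the field \<open>\<phi>\<^sup>2 w y\<close> with \<open>g\<close> the gradient of
  \<open>\<phi>\<close> at a point at position \<open>y\<close> relative to the centre. The term \<open>3 - 2 w \<bar>y\<bar>\<^sup>2\<close>, which
  is at least \<open>1\<close>, is where dimension three is used, and the mixed term is absorbed by completing
  the square.
\<close>

lemma hardy_divergence_bound:
  fixes g y :: "real^3" and \<phi> w h :: real
  assumes h: "h > 0" and w: "w = 1 / ((norm y)\<^sup>2 + h\<^sup>2)"
  shows "\<phi>\<^sup>2 * w / 2 - 2 * (norm g)\<^sup>2 \<le> 2 * \<phi> * w * (g \<bullet> y) + 3 * \<phi>\<^sup>2 * w - 2 * \<phi>\<^sup>2 * w\<^sup>2 * (norm y)\<^sup>2"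
proof -
  have pos: "(norm y)\<^sup>2 + h\<^sup>2 > 0" using h by (simp add: add_nonneg_pos)
  have w0: "0 \<le> w" using pos by (simp add: w)
  have wy: "w * (norm y)\<^sup>2 \<le> 1" using pos by (simp add: w)
  have "(g \<bullet> y)\<^sup>2 \<le> (norm g)\<^sup>2 * (norm y)\<^sup>2"
    using Cauchy_Schwarz_ineq[of g y] by (simp add: power2_norm_eq_inner)
  then have "w * (g \<bullet> y)\<^sup>2 \<le> w * ((norm g)\<^sup>2 * (norm y)\<^sup>2)" using w0 by (rule mult_left_mono)
  also have "\<dots> \<le> (norm g)\<^sup>2" using mult_left_mono[OF wy, of "(norm g)\<^sup>2"] by (simp add: mult_ac)
  finally have 1: "w * (g \<bullet> y)\<^sup>2 \<le> (norm g)\<^sup>2" .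
  have "0 \<le> w * (\<phi> + 2 * (g \<bullet> y))\<^sup>2" using w0 by simp
  then have 2: "0 \<le> w * \<phi>\<^sup>2 + 4 * (\<phi> * w * (g \<bullet> y)) + 4 * (w * (g \<bullet> y)\<^sup>2)"
    by (simp add: power2_sum algebra_simps power_mult_distrib)
  have "(\<phi>\<^sup>2 * w) * (w * (norm y)\<^sup>2) \<le> (\<phi>\<^sup>2 * w) * 1" using w0 wy by (intro mult_left_mono) auto
  then have 3: "\<phi>\<^sup>2 * w\<^sup>2 * (norm y)\<^sup>2 \<le> \<phi>\<^sup>2 * w" by (simp add: power2_eq_square mult_ac)
  show ?thesis using 1 2 3 by (simp add: mult_ac)
qed

text \<open>
  Hardy's inequality with a weight regularized at scale \<open>h\<close>. The shift by \<open>h\<^sup>2\<close> keeps the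
  vector field smooth at \<open>z\<close>, so the divergence theorem is only needed for compactly supported
  \<open>C\<^sup>1\<close> fields, where it says that the integral of the divergence is zero.
\<close>

lemma hardy_test_function:
  fixes z :: "real^3"
  assumes \<phi>: "\<phi> \<in> test_functions U" and h: "h > 0"
  shows "(LINT x|lebesgue. (\<phi> x)\<^sup>2 * (1 / ((norm (x - z))\<^sup>2 + h\<^sup>2))) \<le> 4 * (LINT x|lebesgue. (norm (grad \<phi> x))\<^sup>2)"
proof -
  note T = test_functionD[OF \<phi>]
  define w where "w x = 1 / ((norm (x - z))\<^sup>2 + h\<^sup>2)" for x
  have pos: "(norm (x - z))\<^sup>2 + h\<^sup>2 > 0" for x using h by (simp add: add_nonneg_pos)
  then have pos': "(x - z) \<bullet> (x - z) + h\<^sup>2 > 0" for x by (simp add: power2_norm_eq_inner)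
  have wc: "continuous_on UNIV w"
    unfolding w_def using pos by (intro continuous_intros) (metis less_irrefl)
  have wd: "(w has_derivative (\<lambda>d. - (w x)\<^sup>2 * (2 * ((x - z) \<bullet> d)))) (at x)" for x
    unfolding w_def[abs_def] power2_norm_eq_inner
    using pos'[of x] by (auto intro!: derivative_eq_intros simp: fun_eq_iff inner_commute power2_eq_square field_simps)
  define f where "f i x = (\<phi> x)\<^sup>2 * ((x - z) $ i * w x)" for i x
  define G where "G i x = (2 * \<phi> x * ((x - z) $ i) * w x) *\<^sub>R grad \<phi> x + ((\<phi> x)\<^sup>2 * w x) *\<^sub>R axis i 1
      - (2 * (\<phi> x)\<^sup>2 * ((x - z) $ i) * (w x)\<^sup>2) *\<^sub>R (x - z)" for i x
  have fd: "(f i has_derivative (\<lambda>d. G i x \<bullet> d)) (at x)" for i x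
  proof -
    have n: "((\<lambda>x. (x - z) $ i) has_derivative (\<lambda>d. d $ i)) (at x)"
      by (rule bounded_linear.has_derivative[OF bounded_linear_vec_nth, THEN has_derivative_eq_rhs])
        (auto intro!: derivative_eq_intros)
    show ?thesis
      unfolding f_def[abs_def]
      by (rule has_derivative_eq_rhs,
          (rule has_derivative_mult has_derivative_power has_derivative_grad[OF T(1)] n wd)+)
        (simp add: G_def fun_eq_iff inner_add_left inner_diff_left inner_axis' algebra_simps power2_eq_square)
  qed
  have gf: "grad (f i) = G i" for i using grad_eqI[OF fd] by blast
  have Gc: "continuous_on UNIV (G i)" for i
    unfolding G_def using T(2,4) wc
    by (intro continuous_intros bounded_linear.continuous_on[OF bounded_linear_vec_nth]) auto
  have fs: "{x. f i x \<noteq> 0} \<subseteq> {x. \<phi> x \<noteq> 0}" for i by (auto simp: f_def)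
  have fb: "bounded {x. f i x \<noteq> 0}" for i using bounded_subset[OF T(5) fs] .
  have fdiff: "f i differentiable (at x)" for i x using fd differentiable_def by blast
  have div: "integrable lebesgue (partial (f i) (axis i 1))" "(LINT x|lebesgue. partial (f i) (axis i 1) x) = 0" for i
  proof -
    obtain L where L: "L-lipschitz_on UNIV (f i)"
      using lipschitz_C1_bounded_support[OF fdiff, of i] Gc fb by (auto simp: gf)
    show "integrable lebesgue (partial (f i) (axis i 1))" "(LINT x|lebesgue. partial (f i) (axis i 1) x) = 0"
      using integral_partial_lipschitz[OF L fb] fdiff by auto
  qed
  have sum: "(\<Sum>i\<in>UNIV. partial (f i) (axis i 1) x) =
      2 * \<phi> x * w x * (grad \<phi> x \<bullet> (x - z)) + 3 * (\<phi> x)\<^sup>2 * w x - 2 * (\<phi> x)\<^sup>2 * (w x)\<^sup>2 * (norm (x - z))\<^sup>2" for x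
  proof -
    have "partial (f i) (axis i 1) x = (2 * \<phi> x * w x) * (grad \<phi> x $ i * (x - z) $ i) + (\<phi> x)\<^sup>2 * w x
        - (2 * (\<phi> x)\<^sup>2 * (w x)\<^sup>2) * ((x - z) $ i * (x - z) $ i)" for i
      unfolding partial_has_derivative[OF fd]
      by (simp add: G_def inner_axis algebra_simps)
    then show ?thesis
      unfolding power2_norm_eq_inner inner_vec_def
      by (simp only: sum.distrib sum_subtractf sum_distrib_left[symmetric]) simp
  qed
  have supp: "\<phi> x = 0" if "x \<notin> closure {x. \<phi> x \<noteq> 0}" for x
    using that closure_subset[of "{x. \<phi> x \<noteq> 0}"] by auto
  have "continuous_on UNIV (\<lambda>x. (\<phi> x)\<^sup>2 * w x)" using T(2) wc by (intro continuous_intros)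
  then have iw: "integrable lebesgue (\<lambda>x. (\<phi> x)\<^sup>2 * w x)"
    by (rule integrable_lebesgue_continuous_compact_support[OF _ T(6)]) (drule supp, simp)
  have "continuous_on UNIV (\<lambda>x. (norm (grad \<phi> x))\<^sup>2)" using T(4) by (intro continuous_intros)
  then have ig: "integrable lebesgue (\<lambda>x. (norm (grad \<phi> x))\<^sup>2)"
    by (rule integrable_lebesgue_continuous_compact_support[OF _ T(6)]) (simp add: grad_zero_off_support)
  have "(LINT x|lebesgue. (\<phi> x)\<^sup>2 * w x / 2 - 2 * (norm (grad \<phi> x))\<^sup>2)
      \<le> (LINT x|lebesgue. (\<Sum>i\<in>UNIV. partial (f i) (axis i 1) x))"
  proof (rule integral_mono)
    show "integrable lebesgue (\<lambda>x. \<Sum>i\<in>UNIV. partial (f i) (axis i 1) x)"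
      by (rule Bochner_Integration.integrable_sum) (rule div)
    show "(\<phi> x)\<^sup>2 * w x / 2 - 2 * (norm (grad \<phi> x))\<^sup>2 \<le> (\<Sum>i\<in>UNIV. partial (f i) (axis i 1) x)" for x
      unfolding sum by (rule hardy_divergence_bound[OF h]) (simp add: w_def)
  qed (use iw ig in auto)
  also have "\<dots> = 0"
    using Bochner_Integration.integral_sum[of UNIV lebesgue "\<lambda>i. partial (f i) (axis i 1)"] div by simp
  finally have "(LINT x|lebesgue. (\<phi> x)\<^sup>2 * w x) / 2 - 2 * (LINT x|lebesgue. (norm (grad \<phi> x))\<^sup>2) \<le> 0"
    using iw ig by simp
  then show ?thesis unfolding w_def by simp
qed

text \<open>
  On \<open>S\<close> the Hardy weight is at least \<open>1 / (2 h\<^sup>2)\<close>.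
\<close>

lemma local_poincare_test_function:
  fixes z :: "real^3"
  assumes U: "open U" and \<phi>: "\<phi> \<in> test_functions U" and h: "h > 0"
    and S: "S \<in> sets lebesgue" "S \<subseteq> cball z h"
  shows "(LINT x|lebesgue_on S. (\<phi> x)\<^sup>2) \<le> 8 * h\<^sup>2 * (LINT x|lebesgue_on U. (norm (grad \<phi> x))\<^sup>2)"
proof -
  note T = test_functionD[OF \<phi>]
  have Um: "U \<in> sets lebesgue" using U by (simp add: lborelD)
  have pos: "(norm (x - z))\<^sup>2 + h\<^sup>2 > 0" for x using h by (simp add: add_nonneg_pos)
  have supp: "\<phi> x = 0" if "x \<notin> closure {x. \<phi> x \<noteq> 0}" for x
    using that closure_subset[of "{x. \<phi> x \<noteq> 0}"] by auto
  have "(norm (x - z))\<^sup>2 + h\<^sup>2 \<noteq> 0" for x using pos[of x] by linarith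
  then have "continuous_on UNIV (\<lambda>x. (\<phi> x)\<^sup>2 * (1 / ((norm (x - z))\<^sup>2 + h\<^sup>2)))"
    using T(2) by (intro continuous_intros) auto
  then have iw: "integrable lebesgue (\<lambda>x. (\<phi> x)\<^sup>2 * (1 / ((norm (x - z))\<^sup>2 + h\<^sup>2)))"
    by (rule integrable_lebesgue_continuous_compact_support[OF _ T(6)]) (drule supp, simp)
  have "(LINT x|lebesgue_on S. (\<phi> x)\<^sup>2) = (LINT x|lebesgue. indicator S x * (\<phi> x)\<^sup>2)"
    using S(1) by (simp add: integral_restrict_space)
  also have "\<dots> \<le> (LINT x|lebesgue. 2 * h\<^sup>2 * ((\<phi> x)\<^sup>2 * (1 / ((norm (x - z))\<^sup>2 + h\<^sup>2))))"
  proof (rule integral_mono')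
    show "integrable lebesgue (\<lambda>x. 2 * h\<^sup>2 * ((\<phi> x)\<^sup>2 * (1 / ((norm (x - z))\<^sup>2 + h\<^sup>2))))"
      by (rule integrable_mult_right) (rule iw)
    show "indicator S x * (\<phi> x)\<^sup>2 \<le> 2 * h\<^sup>2 * ((\<phi> x)\<^sup>2 * (1 / ((norm (x - z))\<^sup>2 + h\<^sup>2)))" for x
    proof (cases "x \<in> S")
      case True
      then have "norm (x - z) \<le> h" using S(2) by (auto simp: dist_norm norm_minus_commute)
      then have "(norm (x - z))\<^sup>2 \<le> h\<^sup>2" by (intro power_mono) auto
      then have "1 \<le> 2 * h\<^sup>2 / ((norm (x - z))\<^sup>2 + h\<^sup>2)" using pos[of x] by (simp add: le_divide_eq)
      then have "(\<phi> x)\<^sup>2 * 1 \<le> (\<phi> x)\<^sup>2 * (2 * h\<^sup>2 / ((norm (x - z))\<^sup>2 + h\<^sup>2))" by (intro mult_left_mono) auto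
      then show ?thesis using True by (simp add: mult_ac)
    qed (use pos[of x] in \<open>simp add: less_imp_le\<close>)
  qed (use pos in \<open>simp add: less_imp_le\<close>)
  also have "\<dots> = 2 * h\<^sup>2 * (LINT x|lebesgue. (\<phi> x)\<^sup>2 * (1 / ((norm (x - z))\<^sup>2 + h\<^sup>2)))"
    by (rule integral_mult_right_zero)
  also have "\<dots> \<le> 2 * h\<^sup>2 * (4 * (LINT x|lebesgue. (norm (grad \<phi> x))\<^sup>2))"
    by (intro mult_left_mono hardy_test_function[OF \<phi> h]) simp
  also have "(LINT x|lebesgue. (norm (grad \<phi> x))\<^sup>2) = (LINT x|lebesgue_on U. (norm (grad \<phi> x))\<^sup>2)"
    by (rule integral_lebesgue_on_eq[OF Um, symmetric]) (use T(7) grad_zero_off_support[of _ \<phi>] in auto)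
  finally show ?thesis by simp
qed

lemma integral_lebesgue_on_mono_set:
  fixes f :: "'a::euclidean_space \<Rightarrow> real"
  assumes "S \<in> sets lebesgue" "U \<in> sets lebesgue" "S \<subseteq> U" "integrable (lebesgue_on U) f" "\<And>x. 0 \<le> f x"
  shows "integrable (lebesgue_on S) f" "(LINT x|lebesgue_on S. f x) \<le> (LINT x|lebesgue_on U. f x)"
proof -
  have iU: "integrable lebesgue (\<lambda>x. indicator U x *\<^sub>R f x)"
    using assms by (simp add: integrable_restrict_space)
  have "(\<lambda>x. indicator S x *\<^sub>R indicator U x *\<^sub>R f x) = (\<lambda>x. indicator S x *\<^sub>R f x)"
    using assms(3) by (auto simp: indicator_def fun_eq_iff)
  then have iS: "integrable lebesgue (\<lambda>x. indicator S x *\<^sub>R f x)"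
    using integrable_mult_indicator[OF assms(1) iU] by simp
  then show "integrable (lebesgue_on S) f" using assms by (simp add: integrable_restrict_space)
  have "(LINT x|lebesgue. indicator S x *\<^sub>R f x) \<le> (LINT x|lebesgue. indicator U x *\<^sub>R f x)"
    using assms(3,5) by (intro integral_mono iS iU) (auto simp: indicator_def)
  then show "(LINT x|lebesgue_on S. f x) \<le> (LINT x|lebesgue_on U. f x)"
    using assms by (simp add: integral_restrict_space)
qed

lemma norm_sq_le_2_norm_sq:
  fixes a b :: "'a::real_normed_vector"
  shows "(norm a)\<^sup>2 \<le> 2 * (norm (b - a))\<^sup>2 + 2 * (norm b)\<^sup>2"
proof -
  have "norm a \<le> norm (b - a) + norm b"
    by (metis norm_minus_commute norm_triangle_sub add.commute)
  then have "(norm a)\<^sup>2 \<le> (norm (b - a) + norm b)\<^sup>2" by (intro power_mono) auto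
  also have "\<dots> \<le> 2 * (norm (b - a))\<^sup>2 + 2 * (norm b)\<^sup>2"
    using sum_squares_bound[of "norm (b - a)" "norm b"] by (simp add: power2_sum)
  finally show ?thesis .
qed

text \<open>
  Density of test functions. Splitting squares with \<open>(a + b)\<^sup>2 \<le> 2 a\<^sup>2 + 2 b\<^sup>2\<close>, once for
  the function and once for its gradient, costs the factor 4 in the constant and replaces
  Minkowski's inequality.
\<close>

lemma local_poincare_H10:
  fixes z :: "real^3"
  assumes U: "open U" and u: "u \<in> H10 U" and h: "h > 0"
    and S: "S \<in> sets lebesgue" "S \<subseteq> cball z h" "S \<subseteq> U"
  shows "(LINT x|lebesgue_on S. (u x)\<^sup>2) \<le> 32 * h\<^sup>2 * (LINT x|lebesgue_on U. (norm (weak_gradient U u x))\<^sup>2)"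
proof -
  have Um: "U \<in> sets lebesgue" using U by (simp add: lborelD)
  note H = H10D[OF U u]
  obtain \<phi> where \<phi>: "\<And>n::nat. \<phi> n \<in> test_functions U"
    and l0: "(\<lambda>n. LINT x|lebesgue_on U. (\<phi> n x - u x)\<^sup>2) \<longlonglongrightarrow> 0"
    and l1: "(\<lambda>n. LINT x|lebesgue_on U. (norm (grad (\<phi> n) x - weak_gradient U u x))\<^sup>2) \<longlonglongrightarrow> 0"
    using H(4) by blast
  let ?I = "LINT x|lebesgue_on U. (norm (weak_gradient U u x))\<^sup>2"
  have bound: "(LINT x|lebesgue_on S. (u x)\<^sup>2) \<le> 2 * (LINT x|lebesgue_on U. (\<phi> n x - u x)\<^sup>2) + 2 * (8 * h\<^sup>2 *
      (2 * (LINT x|lebesgue_on U. (norm (grad (\<phi> n) x - weak_gradient U u x))\<^sup>2) + 2 * ?I))" for n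
  proof -
    note t = test_function_Lp[OF \<phi>[of n] U]
    have i1: "integrable (lebesgue_on U) (\<lambda>x. (\<phi> n x - u x)\<^sup>2)"
      using Lp_2_diff[OF t(1) H(1)] by (simp add: Lp_2_iff)
    have i2: "integrable (lebesgue_on U) (\<lambda>x. (\<phi> n x)\<^sup>2)" using t(1) by (simp add: Lp_2_iff)
    have i3: "integrable (lebesgue_on U) (\<lambda>x. (norm (grad (\<phi> n) x - weak_gradient U u x))\<^sup>2)"
      using Lp_2_diff[OF t(2) H(3)] by (simp add: Lp_2_iff)
    have i4: "integrable (lebesgue_on U) (\<lambda>x. (norm (weak_gradient U u x))\<^sup>2)"
      using H(3) by (simp add: Lp_2_iff)
    have i5: "integrable (lebesgue_on U) (\<lambda>x. (norm (grad (\<phi> n) x))\<^sup>2)"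
      using t(2) by (simp add: Lp_2_iff)
    have i6: "integrable (lebesgue_on U) (\<lambda>x. (u x)\<^sup>2)" using H(1) by (simp add: Lp_2_iff)
    note m1 = integral_lebesgue_on_mono_set[OF S(1) Um S(3) i1]
    note m2 = integral_lebesgue_on_mono_set[OF S(1) Um S(3) i2]
    note m6 = integral_lebesgue_on_mono_set[OF S(1) Um S(3) i6]
    have "(LINT x|lebesgue_on S. (u x)\<^sup>2) \<le> (LINT x|lebesgue_on S. 2 * (\<phi> n x - u x)\<^sup>2 + 2 * (\<phi> n x)\<^sup>2)"
      using norm_sq_le_2_norm_sq[of "u x" "\<phi> n x" for x] m1 m2 m6
      by (intro integral_mono) auto
    also have "\<dots> = 2 * (LINT x|lebesgue_on S. (\<phi> n x - u x)\<^sup>2) + 2 * (LINT x|lebesgue_on S. (\<phi> n x)\<^sup>2)"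
      using m1(1) m2(1) by simp
    also have "\<dots> \<le> 2 * (LINT x|lebesgue_on U. (\<phi> n x - u x)\<^sup>2) + 2 * (8 * h\<^sup>2 * (LINT x|lebesgue_on U. (norm (grad (\<phi> n) x))\<^sup>2))"
      using m1(2) local_poincare_test_function[OF U \<phi> h S(1,2)] by (intro add_mono mult_left_mono) auto
    also have "(LINT x|lebesgue_on U. (norm (grad (\<phi> n) x))\<^sup>2) \<le>
        (LINT x|lebesgue_on U. 2 * (norm (grad (\<phi> n) x - weak_gradient U u x))\<^sup>2 + 2 * (norm (weak_gradient U u x))\<^sup>2)"
      using norm_sq_le_2_norm_sq[of "grad (\<phi> n) x" "weak_gradient U u x" for x] i3 i4 i5
      by (intro integral_mono) (auto simp: norm_minus_commute)
    also have "\<dots> = 2 * (LINT x|lebesgue_on U. (norm (grad (\<phi> n) x - weak_gradient U u x))\<^sup>2) + 2 * ?I"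
      using i3 i4 by simp
    finally show ?thesis by (simp add: mult_left_mono)
  qed
  have "(\<lambda>n. 2 * (LINT x|lebesgue_on U. (\<phi> n x - u x)\<^sup>2) + 2 * (8 * h\<^sup>2 *
      (2 * (LINT x|lebesgue_on U. (norm (grad (\<phi> n) x - weak_gradient U u x))\<^sup>2) + 2 * ?I)))
      \<longlonglongrightarrow> 2 * 0 + 2 * (8 * h\<^sup>2 * (2 * 0 + 2 * ?I))"
    by (intro tendsto_intros l0 l1)
  then have "(LINT x|lebesgue_on S. (u x)\<^sup>2) \<le> 2 * 0 + 2 * (8 * h\<^sup>2 * (2 * 0 + 2 * ?I))"
    by (rule LIMSEQ_le_const) (use bound in blast)
  then show ?thesis by simp
qed

section \<open>Piecewise affine functions in the energy space\<close>

lemma norm_grad_le: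
  fixes u :: "real^'n::finite \<Rightarrow> real"
  assumes u: "L-lipschitz_on UNIV u" and d: "u differentiable (at x)"
  shows "norm (grad u x) \<le> L"
proof -
  have "(norm (grad u x))\<^sup>2 = partial u (grad u x) x"
    by (simp add: frechet_derivative_grad[OF d] power2_norm_eq_inner)
  also have "\<dots> \<le> L * norm (grad u x)" using partial_lipschitz_bound[OF u d, of "grad u x"] by linarith
  finally show ?thesis
    using lipschitz_on_nonneg[OF u] by (cases "norm (grad u x) = 0") (auto simp: power2_eq_square)
qed

text \<open>
  The function \<open>v\<close> may be nonzero up to the boundary of \<open>\<Omega>\<close>, so mollifying it directly would
  leave \<open>\<Omega>\<close>. Since \<open>\<Omega>\<close> is convex, contracting the support towards \<open>x0\<close> by the
  factor \<open>1 / (1 + s)\<close> moves it to a compact subset of \<open>\<Omega>\<close>, which leaves room for a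
  mollification of radius at most \<open>s\<close>.
\<close>

lemma dilated_test_functions:
  fixes v :: "real^3 \<Rightarrow> real"
  assumes \<Omega>: "open \<Omega>" "convex \<Omega>" "bounded \<Omega>" and x0: "x0 \<in> \<Omega>"
    and v: "L-lipschitz_on UNIV v" and supp: "{x. v x \<noteq> 0} \<subseteq> \<Omega>"
    and s: "0 < s" "s \<le> 1"
  obtains \<phi> where "\<phi> \<in> test_functions \<Omega>" "(2 * L)-lipschitz_on UNIV \<phi>"
    "\<And>x. \<bar>\<phi> x - v x\<bar> \<le> s * (2 * L + L * dist x x0)"
    "\<And>x r a c. s * (1 + dist x x0 + r) < r / 2 \<Longrightarrow> 0 < r \<Longrightarrow>  (\<And>y. y \<in> ball x r \<Longrightarrow> v y = a \<bullet> y + c) \<Longrightarrow>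
      grad \<phi> x = (1 + s) *\<^sub>R a"
proof -
  have L0: "0 \<le> L" using lipschitz_on_nonneg[OF v] .
  \<comment> \<open>The dilation about \<open>x0\<close> and its inverse.\<close>
  define D where "D y = x0 + (1 + s) *\<^sub>R (y - x0)" for y
  define E where "E y = y - (s / (1 + s)) *\<^sub>R (y - x0)" for y
  have ED: "E (D y) = y" for y
  proof -
    have "D y - x0 = (1 + s) *\<^sub>R (y - x0)" by (simp add: D_def)
    then have "E (D y) = D y - s *\<^sub>R (y - x0)" using s by (simp add: E_def)
    then show ?thesis by (simp add: D_def algebra_simps)
  qed
  define S where "S = E ` closure \<Omega>"
  have Sc: "compact S"
    unfolding S_def E_def using \<Omega>(3) by (intro compact_continuous_image continuous_intros) auto
  have S\<Omega>: "S \<subseteq> \<Omega>"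
  proof
    fix x assume "x \<in> S"
    then obtain y where y: "y \<in> closure \<Omega>" "x = E y" by (auto simp: S_def)
    have "y - (s / (1 + s)) *\<^sub>R (y - x0) \<in> interior \<Omega>"
      by (rule mem_interior_closure_convex_shrink) (use \<Omega> x0 y s in \<open>auto simp: interior_open\<close>)
    then show "x \<in> \<Omega>" using y \<Omega>(1) by (simp add: E_def interior_open)
  qed
  have Sne: "S \<noteq> {}" using x0 closure_subset by (auto simp: S_def)
  define g where "g y = v (D y)" for y
  have gS: "x \<in> S" if "g x \<noteq> 0" for x
  proof -
    have "D x \<in> closure \<Omega>" using that supp closure_subset by (auto simp: g_def)
    then show ?thesis unfolding S_def using ED by (metis image_eqI)
  qed
  have gL: "(2 * L)-lipschitz_on UNIV g"
  proof (rule lipschitz_onI)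
    fix x y
    have "dist (g x) (g y) \<le> L * dist (D x) (D y)" unfolding g_def by (rule lipschitz_onD[OF v]) auto
    also have "dist (D x) (D y) = (1 + s) * dist x y"
    proof -
      have "D x - D y = (1 + s) *\<^sub>R (x - y)" by (simp add: D_def algebra_simps)
      then show ?thesis using s by (simp add: dist_norm)
    qed
    also have "L * ((1 + s) * dist x y) \<le> L * (2 * dist x y)"
      using s L0 by (intro mult_left_mono mult_right_mono) auto
    finally show "dist (g x) (g y) \<le> 2 * L * dist x y" by simp
  qed (use L0 in simp)
  have gb: "bounded {x. g x \<noteq> 0}"
    by (rule bounded_subset[OF compact_imp_bounded[OF Sc]]) (use gS in auto)
  obtain e where e: "e > 0" "{x. infdist x S \<le> e} \<subseteq> \<Omega>"
    using compact_in_open_separated[OF Sne Sc \<Omega>(1) S\<Omega>] by blast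
  define K where "K = {x. infdist x S \<le> e}"
  have K: "compact K" unfolding K_def by (rule compact_infdist_le[OF Sne Sc e(1)])
  define \<epsilon> where "\<epsilon> = min e s"
  have \<epsilon>: "0 < \<epsilon>" "\<epsilon> \<le> e" "\<epsilon> \<le> s" using e s by (auto simp: \<epsilon>_def)
  obtain \<phi> where \<phi>: "\<And>k. Ck k \<phi>" "(2 * L)-lipschitz_on UNIV \<phi>" "\<And>x. \<bar>\<phi> x - g x\<bar> \<le> 2 * L * \<epsilon>"
    "\<And>x. \<phi> x \<noteq> 0 \<Longrightarrow> \<exists>y. g y \<noteq> 0 \<and> dist x y < \<epsilon>"
    "\<And>x r a c. \<epsilon> < r \<Longrightarrow> (\<And>y. y \<in> ball x r \<Longrightarrow> g y = a \<bullet> y + c) \<Longrightarrow>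
      (\<phi> has_derivative (\<lambda>h. a \<bullet> h)) (at x)"
    using mollify[OF gL gb \<epsilon>(1)] by metis
  show ?thesis
  proof (rule that[of \<phi>])
    have "x \<in> K" if nz: "\<phi> x \<noteq> 0" for x
    proof -
      obtain y where y: "g y \<noteq> 0" "dist x y < \<epsilon>" using \<phi>(4)[OF nz] by blast
      have "infdist x S \<le> dist x y" using gS[OF y(1)] by (rule infdist_le)
      then show ?thesis using y(2) \<epsilon>(2) by (simp add: K_def)
    qed
    then have sK: "{x. \<phi> x \<noteq> 0} \<subseteq> K" by auto
    then have "closure {x. \<phi> x \<noteq> 0} \<subseteq> K"
      using K by (intro closure_minimal compact_imp_closed)
    moreover have "compact (closure {x. \<phi> x \<noteq> 0})"
      using bounded_subset[OF compact_imp_bounded[OF K] sK] by simp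
    ultimately show "\<phi> \<in> test_functions \<Omega>"
      using \<phi>(1) e(2) by (auto simp: test_functions_def K_def)
    show "(2 * L)-lipschitz_on UNIV \<phi>" by (rule \<phi>(2))
    show "\<bar>\<phi> x - v x\<bar> \<le> s * (2 * L + L * dist x x0)" for x
    proof -
      have "\<bar>g x - v x\<bar> \<le> L * dist (D x) x"
        using lipschitz_onD[OF v, of "D x" x] by (simp add: g_def dist_real_def)
      also have "dist (D x) x = s * dist x x0"
      proof -
        have "D x - x = s *\<^sub>R (x - x0)" by (simp add: D_def algebra_simps)
        then show ?thesis using s by (simp add: dist_norm)
      qed
      finally have "\<bar>g x - v x\<bar> \<le> L * (s * dist x x0)" .
      moreover have "2 * L * \<epsilon> \<le> 2 * L * s" using \<epsilon> L0 by (intro mult_left_mono) auto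
      ultimately show ?thesis using \<phi>(3)[of x] by (simp add: algebra_simps)
    qed
    show "grad \<phi> x = (1 + s) *\<^sub>R a"
      if r: "s * (1 + dist x x0 + r) < r / 2" "0 < r" and aff: "\<And>y. y \<in> ball x r \<Longrightarrow> v y = a \<bullet> y + c" for x r a c
    proof (rule grad_eqI, rule \<phi>(5))
      have "s * 1 \<le> s * (1 + dist x x0 + r)" using s r(2) by (intro mult_left_mono) auto
      then show "\<epsilon> < r / 2" using \<epsilon>(3) r(1) by linarith
      fix y assume y: "y \<in> ball x (r / 2)"
      have "dist x (D y) \<le> dist x y + dist y (D y)" by (rule dist_triangle)
      also have "dist y (D y) = s * dist y x0"
      proof -
        have "y - D y = - (s *\<^sub>R (y - x0))" by (simp add: D_def algebra_simps)
        then show ?thesis using s by (simp add: dist_norm)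
      qed
      also have "s * dist y x0 \<le> s * (1 + dist x x0 + r)"
        using dist_triangle[of y x0 x] y s r(2) by (intro mult_left_mono) (auto simp: dist_commute)
      finally have "D y \<in> ball x r" using y r(1) by simp
      from aff[OF this] show "g y = (1 + s) *\<^sub>R a \<bullet> y + (c - s * (a \<bullet> x0))"
        by (simp add: g_def D_def algebra_simps inner_add_right inner_diff_right)
    qed
  qed
qed

text \<open>
  The approximations converge pointwise together with their gradients, off the null set \<open>N\<close>, and
  share one Lipschitz constant. As \<open>\<Omega>\<close> is bounded, dominated convergence gives convergence in
  the energy norm.
\<close>

lemma piecewise_affine_in_H10:
  fixes v :: "real^3 \<Rightarrow> real"
  assumes \<Omega>: "open \<Omega>" "convex \<Omega>" "bounded \<Omega>" "\<Omega> \<noteq> {}"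
    and v: "L-lipschitz_on UNIV v" and supp: "{x. v x \<noteq> 0} \<subseteq> \<Omega>"
    and N: "negligible N"
    and aff: "\<And>x. x \<notin> N \<Longrightarrow> \<exists>r>0. \<exists>a c. \<forall>y\<in>ball x r. v y = a \<bullet> y + c"
  shows "v \<in> H10 \<Omega>" "has_weak_gradient \<Omega> v (grad v)"
proof -
  have \<Omega>m: "\<Omega> \<in> sets lebesgue" using \<Omega>(1) by (simp add: lborelD)
  have L0: "0 \<le> L" using lipschitz_on_nonneg[OF v] .
  obtain x0 where x0: "x0 \<in> \<Omega>" using \<Omega>(4) by blast
  obtain R where R: "\<And>x. x \<in> \<Omega> \<Longrightarrow> dist x x0 \<le> R"
    using \<Omega>(3) unfolding bounded_any_center[of _ x0] by (auto simp: dist_commute)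
  have vD: "(v has_derivative (\<lambda>h. a \<bullet> h)) (at x)" if "r > 0" "\<And>y. y \<in> ball x r \<Longrightarrow> v y = a \<bullet> y + c" for x r a c
    by (rule has_derivative_transform_within_open[where s="ball x r" and f="\<lambda>y. a \<bullet> y + c"])
      (use that in \<open>auto intro!: derivative_eq_intros\<close>)
  have vdiff: "v differentiable (at x)" if "x \<notin> N" for x
    using aff[OF that] vD unfolding differentiable_def by blast
  have aeN: "AE x in lebesgue. x \<notin> N"
    using N unfolding negligible_iff_null_sets by (rule AE_not_in)
  have vd: "AE x in lebesgue. v differentiable (at x)"
    using aeN by eventually_elim (rule vdiff)
  have vb: "bounded {x. v x \<noteq> 0}" using bounded_subset[OF \<Omega>(3) supp] .
  show wg: "has_weak_gradient \<Omega> v (grad v)" by (rule has_weak_gradient_grad[OF v vb vd \<Omega>(1)])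
  have finU: "integrable (lebesgue_on \<Omega>) (\<lambda>x. c)" for c :: real
    using lmeasurable_open[OF \<Omega>(3,1)] \<Omega>m
    by (simp add: integrable_restrict_space lmeasurable_iff_integrable[symmetric])
  have vc: "continuous_on UNIV v" using v lipschitz_on_continuous_on by blast
  have vL: "v \<in> Lp 2 \<Omega>"
    by (rule Lp_2_continuous[OF vc, of "closure {x. v x \<noteq> 0}"])
      (use vb \<Omega>m closure_subset[of "{x. v x \<noteq> 0}"] in auto)
  have gm: "grad v \<in> borel_measurable (lebesgue_on \<Omega>)"
    using integrable_grad_lipschitz[OF v vb vd] by (intro measurable_restrict_space1) auto
  have aeN\<Omega>: "AE x in lebesgue_on \<Omega>. x \<in> \<Omega> \<and> x \<notin> N"
  proof (subst AE_restrict_space_iff)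
    show "AE x in lebesgue. x \<in> \<Omega> \<longrightarrow> x \<in> \<Omega> \<and> x \<notin> N" using aeN by eventually_elim simp
  qed (use \<Omega>m in simp)
  have gL: "grad v \<in> Lp 2 \<Omega>"
  proof -
    have "integrable (lebesgue_on \<Omega>) (\<lambda>x. (norm (grad v x))\<^sup>2)"
    proof (rule Bochner_Integration.integrable_bound[OF finU[of "L\<^sup>2"]])
      show "AE x in lebesgue_on \<Omega>. norm ((norm (grad v x))\<^sup>2) \<le> norm (L\<^sup>2)"
        using aeN\<Omega> by eventually_elim (use norm_grad_le[OF v vdiff] in \<open>auto intro: power_mono\<close>)
    qed (use gm in measurable)
    then show ?thesis using gm by (simp add: Lp_2_iff)
  qed
  define s where "s n = 1 / real (Suc n)" for n
  have s: "0 < s n" "s n \<le> 1" for n by (auto simp: s_def)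
  have slim: "s \<longlonglongrightarrow> 0" unfolding s_def by (rule LIMSEQ_Suc[OF lim_inverse_n'])
  have "\<exists>\<phi>. \<phi> \<in> test_functions \<Omega> \<and> (2 * L)-lipschitz_on UNIV \<phi> \<and>
    (\<forall>x. \<bar>\<phi> x - v x\<bar> \<le> s n * (2 * L + L * dist x x0)) \<and>
    (\<forall>x r a c. s n * (1 + dist x x0 + r) < r / 2 \<longrightarrow> 0 < r \<longrightarrow> (\<forall>y. y \<in> ball x r \<longrightarrow> v y = a \<bullet> y + c) \<longrightarrow>
      grad \<phi> x = (1 + s n) *\<^sub>R a)" for n
    by (rule dilated_test_functions[OF \<Omega>(1-3) x0 v supp s[of n]]) blast
  then obtain \<phi> where \<phi>: "\<And>n. \<phi> n \<in> test_functions \<Omega>" "\<And>n. (2 * L)-lipschitz_on UNIV (\<phi> n)"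
    "\<And>n x. \<bar>\<phi> n x - v x\<bar> \<le> s n * (2 * L + L * dist x x0)"
    "\<And>n x r a c. s n * (1 + dist x x0 + r) < r / 2 \<Longrightarrow> 0 < r \<Longrightarrow> (\<forall>y. y \<in> ball x r \<longrightarrow> v y = a \<bullet> y + c) \<Longrightarrow>
      grad (\<phi> n) x = (1 + s n) *\<^sub>R a" by metis
  note t = test_function_Lp[OF \<phi>(1) \<Omega>(1)]
  have l0: "(\<lambda>n. LINT x|lebesgue_on \<Omega>. (\<phi> n x - v x)\<^sup>2) \<longlonglongrightarrow> (LINT x|lebesgue_on \<Omega>. 0)"
  proof (rule integral_dominated_convergence[OF _ _ finU[of "(2 * L + L * R)\<^sup>2"]])
    show "(\<lambda>x. (\<phi> n x - v x)\<^sup>2) \<in> borel_measurable (lebesgue_on \<Omega>)" for n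
      using Lp_2_diff[OF t(1) vL, of n] by (simp add: Lp_2_iff borel_measurable_integrable)
    show "AE x in lebesgue_on \<Omega>. (\<lambda>n. (\<phi> n x - v x)\<^sup>2) \<longlonglongrightarrow> 0"
    proof (rule AE_I2)
      fix x
      have "(\<lambda>n. s n * (2 * L + L * dist x x0)) \<longlonglongrightarrow> 0 * (2 * L + L * dist x x0)"
        by (intro tendsto_intros slim)
      then have lim0: "(\<lambda>n. s n * (2 * L + L * dist x x0)) \<longlonglongrightarrow> 0"
        by (simp only: mult_zero_left)
      have "(\<lambda>n. \<phi> n x - v x) \<longlonglongrightarrow> 0"
        by (rule Lim_null_comparison[OF always_eventually lim0]) (simp only: real_norm_def \<phi>(3) simp_thms)
      then have "(\<lambda>n. (\<phi> n x - v x)\<^sup>2) \<longlonglongrightarrow> 0\<^sup>2" by (rule tendsto_power)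
      then show "(\<lambda>n. (\<phi> n x - v x)\<^sup>2) \<longlonglongrightarrow> 0" by simp
    qed
    show "AE x in lebesgue_on \<Omega>. norm ((\<phi> n x - v x)\<^sup>2) \<le> (2 * L + L * R)\<^sup>2" for n
      using aeN\<Omega>
    proof eventually_elim
      case (elim x)
      have "\<bar>\<phi> n x - v x\<bar> \<le> s n * (2 * L + L * dist x x0)" by (rule \<phi>(3))
      also have "\<dots> \<le> 1 * (2 * L + L * R)"
        using s[of n] L0 R elim by (intro mult_mono add_mono mult_left_mono) auto
      finally have "\<bar>\<phi> n x - v x\<bar> \<le> 2 * L + L * R" by simp
      then have "\<bar>\<phi> n x - v x\<bar>\<^sup>2 \<le> (2 * L + L * R)\<^sup>2" by (intro power_mono) auto
      then show ?case by simp
    qed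
  qed simp
  have l1: "(\<lambda>n. LINT x|lebesgue_on \<Omega>. (norm (grad (\<phi> n) x - grad v x))\<^sup>2) \<longlonglongrightarrow> (LINT x|lebesgue_on \<Omega>. 0)"
  proof (rule integral_dominated_convergence[OF _ _ finU[of "(3 * L)\<^sup>2"]])
    show "(\<lambda>x. (norm (grad (\<phi> n) x - grad v x))\<^sup>2) \<in> borel_measurable (lebesgue_on \<Omega>)" for n
      using Lp_2_diff[OF t(2) gL, of n] by (simp add: Lp_2_iff borel_measurable_integrable)
    show "AE x in lebesgue_on \<Omega>. (\<lambda>n. (norm (grad (\<phi> n) x - grad v x))\<^sup>2) \<longlonglongrightarrow> 0"
      using aeN\<Omega>
    proof eventually_elim
      case (elim x)
      then obtain r a c where r: "r > 0" "\<forall>y\<in>ball x r. v y = a \<bullet> y + c" using aff by blast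
      have ga: "grad v x = a" using r by (intro grad_eqI vD) auto
      have "(\<lambda>n. s n * (1 + dist x x0 + r)) \<longlonglongrightarrow> 0 * (1 + dist x x0 + r)"
        by (intro tendsto_intros slim)
      then have "eventually (\<lambda>n. s n * (1 + dist x x0 + r) < r / 2) sequentially"
        using r(1) by (intro order_tendstoD(2)[where y=0]) auto
      moreover have "grad (\<phi> n) x = (1 + s n) *\<^sub>R a" if "s n * (1 + dist x x0 + r) < r / 2" for n
        using \<phi>(4)[OF that r(1), of a c] r(2) by blast
      ultimately have ev: "eventually (\<lambda>n. (1 + s n) *\<^sub>R a = grad (\<phi> n) x) sequentially"
        by (auto elim: eventually_mono)
      have "(\<lambda>n. (1 + s n) *\<^sub>R a) \<longlonglongrightarrow> (1 + 0) *\<^sub>R a" by (intro tendsto_intros slim)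
      then have "(\<lambda>n. (1 + s n) *\<^sub>R a) \<longlonglongrightarrow> a" by simp
      then have "(\<lambda>n. grad (\<phi> n) x) \<longlonglongrightarrow> a" by (rule Lim_transform_eventually[OF _ ev])
      then have "(\<lambda>n. (norm (grad (\<phi> n) x - a))\<^sup>2) \<longlonglongrightarrow> (norm (a - a))\<^sup>2" by (intro tendsto_intros)
      then show ?case by (simp add: ga)
    qed
    show "AE x in lebesgue_on \<Omega>. norm ((norm (grad (\<phi> n) x - grad v x))\<^sup>2) \<le> (3 * L)\<^sup>2" for n
      using aeN\<Omega>
    proof eventually_elim
      case (elim x)
      have "norm (grad (\<phi> n) x - grad v x) \<le> 2 * L + L"
        using norm_triangle_ineq4[of "grad (\<phi> n) x" "grad v x"] norm_grad_le[OF v vdiff, of x] elim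
          norm_grad_le[OF \<phi>(2) test_functionD(1)[OF \<phi>(1)], of n x] by linarith
      then have "(norm (grad (\<phi> n) x - grad v x))\<^sup>2 \<le> (3 * L)\<^sup>2" by (intro power_mono) auto
      then show ?case by simp
    qed
  qed simp
  show "v \<in> H10 \<Omega>" by (rule H10I[OF \<Omega>(1) vL wg gL \<phi>(1)]) (use l0 l1 in auto)
qed

lemma simplex_negligible_frontier: "n simplex \<tau> \<Longrightarrow> negligible (frontier \<tau>)"
  by (intro negligible_convex_frontier convex_simplex)

lemma tetrahedral_meshD:
  assumes "tetrahedral_mesh \<T>"
  shows "finite \<T>" "\<And>\<tau>. \<tau> \<in> \<T> \<Longrightarrow> 3 simplex \<tau>"
  using assms by (auto simp: tetrahedral_mesh_def triangulation_def)

lemma interior_subset_mesh_domain: "\<tau> \<in> \<T> \<Longrightarrow> interior \<tau> \<subseteq> mesh_domain \<T>"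
  unfolding mesh_domain_def by (rule interior_mono) auto

text \<open>
  On a segment, the closed tetrahedra and the complement of the mesh domain form a finite closed
  cover, and on each piece the function is affine or zero. The sum of the norms of all slopes serves
  as a common Lipschitz constant.
\<close>

lemma P1_space0_lipschitz:
  assumes v: "v \<in> P1_space0 \<T>" and T: "tetrahedral_mesh \<T>"
  obtains L where "L-lipschitz_on UNIV v"
proof -
  have fin: "finite \<T>" and cl: "\<And>\<tau>. \<tau> \<in> \<T> \<Longrightarrow> closed \<tau>"
    using tetrahedral_meshD[OF T] closed_simplex by blast+
  have z: "\<And>x. x \<notin> mesh_domain \<T> \<Longrightarrow> v x = 0" using v by (auto simp: P1_space0_def)
  have "\<forall>\<tau>\<in>\<T>. \<exists>a b. \<forall>x\<in>\<tau>. v x = a \<bullet> x + b" using v by (auto simp: P1_space0_def P1_space_def)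
  then obtain a b where ab: "\<And>\<tau> x. \<tau> \<in> \<T> \<Longrightarrow> x \<in> \<tau> \<Longrightarrow> v x = a \<tau> \<bullet> x + b \<tau>" by metis
  define L where "L = (\<Sum>\<tau>\<in>\<T>. norm (a \<tau>))"
  have L0: "0 \<le> L" by (simp add: L_def sum_nonneg)
  have aL: "norm (a \<tau>) \<le> L" if "\<tau> \<in> \<T>" for \<tau>
    unfolding L_def using fin that by (intro member_le_sum) auto
  have "L-lipschitz_on UNIV v"
  proof (rule lipschitz_onI[OF _ L0])
    fix x y :: "real^3"
    \<comment> \<open>The parametrized segment from \<open>x\<close> to \<open>y\<close> reduces the claim to a function on \<open>{0..1}\<close>.\<close>
    define p where "p t = x + t *\<^sub>R (y - x)" for t :: real
    have pc: "continuous_on UNIV p" unfolding p_def by (intro continuous_intros)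
    have "(L * dist x y)-lipschitz_on {0..1} (\<lambda>t. v (p t))"
    proof (rule lipschitz_on_closed_Union[where I="insert (- mesh_domain \<T>) \<T>" and U="\<lambda>S. p -` S"])
      fix S assume S: "S \<in> insert (- mesh_domain \<T>) \<T>"
      then have "closed S" using cl by (auto simp: mesh_domain_def open_closed[symmetric])
      then show "closed (p -` S)" using pc by (rule closed_vimage) 
      show "(L * dist x y)-lipschitz_on (p -` S) (\<lambda>t. v (p t))"
      proof (rule lipschitz_onI)
        fix s t assume st: "s \<in> p -` S" "t \<in> p -` S"
        show "dist (v (p s)) (v (p t)) \<le> L * dist x y * dist s t"
        proof (cases "S \<in> \<T>")
          case True
          have "v (p s) - v (p t) = a S \<bullet> (p s - p t)"
            using ab[OF True] st by (simp add: inner_diff_right)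
          also have "p s - p t = (s - t) *\<^sub>R (y - x)" by (simp add: p_def algebra_simps)
          finally have "\<bar>v (p s) - v (p t)\<bar> = \<bar>s - t\<bar> * \<bar>a S \<bullet> (y - x)\<bar>" by (simp add: abs_mult)
          also have "\<dots> \<le> \<bar>s - t\<bar> * (L * norm (y - x))"
            using Cauchy_Schwarz_ineq2[of "a S" "y - x"] mult_right_mono[OF aL[OF True], of "norm (y - x)"]
            by (intro mult_left_mono) auto
          finally show ?thesis by (simp add: dist_real_def dist_norm norm_minus_commute mult_ac)
        next
          case False
          then have "v (p s) = 0" "v (p t) = 0" using S st z by auto
          then show ?thesis using L0 by simp
        qed
      qed (use L0 in simp)
    next
      show "{0..1} \<subseteq> (\<Union>S\<in>insert (- mesh_domain \<T>) \<T>. p -` S)"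
        using interior_subset[of "\<Union>\<T>"] by (auto simp: mesh_domain_def)
    qed (use fin L0 in auto)
    from lipschitz_onD[OF this, of 1 0]
    show "dist (v x) (v y) \<le> L * dist x y" by (simp add: p_def dist_commute)
  qed
  then show ?thesis by (rule that)
qed

lemma P1_space0_locally_affine:
  assumes v: "v \<in> P1_space0 \<T>" and T: "tetrahedral_mesh \<T>" and x: "x \<notin> (\<Union>\<tau>\<in>\<T>. frontier \<tau>)"
  shows "\<exists>r>0. \<exists>a c. \<forall>y\<in>ball x r. v y = a \<bullet> y + c"
    "x \<notin> mesh_domain \<T> \<Longrightarrow> \<exists>r>0. \<forall>y\<in>ball x r. v y = 0"
proof -
  have fin: "finite \<T>" and cl: "\<And>\<tau>. \<tau> \<in> \<T> \<Longrightarrow> closed \<tau>"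
    using tetrahedral_meshD[OF T] closed_simplex by blast+
  have in_int: "x \<in> interior \<tau>" if "\<tau> \<in> \<T>" "x \<in> \<tau>" for \<tau>
    using that x cl by (auto simp: frontier_def)
  have out: "\<exists>r>0. \<forall>y\<in>ball x r. v y = 0" if "x \<notin> \<Union>\<T>"
  proof -
    have "open (- \<Union>\<T>)" using fin cl by (auto simp: open_Compl)
    moreover have "x \<in> - \<Union>\<T>" using that by blast
    ultimately obtain r where r: "r > 0" "ball x r \<subseteq> - \<Union>\<T>" by (rule openE)
    have "v y = 0" if "y \<in> ball x r" for y
    proof -
      have "y \<notin> \<Union>\<T>" using r(2) that by blast
      then have "y \<notin> mesh_domain \<T>" using interior_subset[of "\<Union>\<T>"] by (auto simp: mesh_domain_def)
      then show ?thesis using v by (simp add: P1_space0_def)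
    qed
    then show ?thesis using r(1) by blast
  qed
  show "\<exists>r>0. \<exists>a c. \<forall>y\<in>ball x r. v y = a \<bullet> y + c"
  proof (cases "x \<in> \<Union>\<T>")
    case True
    then obtain \<tau> where \<tau>: "\<tau> \<in> \<T>" "x \<in> interior \<tau>" using in_int by blast
    then obtain r where r: "r > 0" "ball x r \<subseteq> \<tau>" using mem_interior by metis
    have "\<exists>a c. \<forall>x\<in>\<tau>. v x = a \<bullet> x + c" using v \<tau>(1) by (simp add: P1_space0_def P1_space_def)
    then obtain a c where "\<forall>x\<in>\<tau>. v x = a \<bullet> x + c" by blast
    then show ?thesis using r by blast
  next
    case False
    from out[OF this] obtain r where "r > 0" "\<forall>y\<in>ball x r. v y = 0 \<bullet> y + 0" by auto
    then show ?thesis by blast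
  qed
  show "\<exists>r>0. \<forall>y\<in>ball x r. v y = 0" if "x \<notin> mesh_domain \<T>"
    using that in_int interior_subset_mesh_domain out by blast
qed

text \<open>
  Off the faces of the mesh a discrete function is locally affine, and outside the mesh it is locally
  zero; the faces are contained in the boundaries of finitely many convex sets, hence form a null set.
\<close>

lemma P1_space0_H10:
  assumes \<Omega>: "open \<Omega>" "convex \<Omega>" "bounded \<Omega>" "\<Omega> \<noteq> {}"
    and T: "tetrahedral_mesh \<T>" "mesh_domain \<T> \<subseteq> \<Omega>" and v: "v \<in> P1_space0 \<T>"
  shows "v \<in> H10 \<Omega>" "AE x in lebesgue_on \<Omega>. x \<notin> mesh_domain \<T> \<longrightarrow> weak_gradient \<Omega> v x = 0"
proof -
  obtain L where L: "L-lipschitz_on UNIV v" using P1_space0_lipschitz[OF v T(1)] .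
  have supp: "{x. v x \<noteq> 0} \<subseteq> \<Omega>" using v T(2) by (auto simp: P1_space0_def)
  let ?N = "\<Union>\<tau>\<in>\<T>. frontier \<tau>"
  have N: "negligible ?N"
    using tetrahedral_meshD[OF T(1)] simplex_negligible_frontier by (intro negligible_Union) blast+
  have H: "v \<in> H10 \<Omega>" "has_weak_gradient \<Omega> v (grad v)"
    using piecewise_affine_in_H10[OF \<Omega> L supp N] P1_space0_locally_affine(1)[OF v T(1)] by blast+
  show "v \<in> H10 \<Omega>" by (rule H(1))
  have \<Omega>m: "\<Omega> \<in> sets lebesgue" using \<Omega>(1) by (simp add: lborelD)
  have "AE x in lebesgue. x \<notin> ?N" using N unfolding negligible_iff_null_sets by (rule AE_not_in)
  then have "AE x in lebesgue. x \<in> \<Omega> \<longrightarrow> x \<notin> ?N" by eventually_elim simp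
  then have "AE x in lebesgue_on \<Omega>. x \<notin> ?N" using \<Omega>m by (subst AE_restrict_space_iff) auto
  with weak_gradient_eq(2)[OF \<Omega>(1) H(2)]
  show "AE x in lebesgue_on \<Omega>. x \<notin> mesh_domain \<T> \<longrightarrow> weak_gradient \<Omega> v x = 0"
  proof eventually_elim
    case (elim x)
    show ?case
    proof
      assume "x \<notin> mesh_domain \<T>"
      from P1_space0_locally_affine(2)[OF v T(1) elim(2) this]
      obtain r where r: "r > 0" "\<forall>y\<in>ball x r. v y = 0" by blast
      have "grad v x = 0"
        by (rule grad_eqI, rule has_derivative_transform_within_open[where s="ball x r" and f="\<lambda>_. 0"])
          (use r in auto)
      then show "weak_gradient \<Omega> v x = 0" using elim(1) by simp
    qed
  qed
qed

section \<open>Green's functions\<close>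

lemma regularized_delta_L2:
  assumes "regularized_delta \<T> h K z \<delta>" and h: "0 < h"
  obtains \<tau> where "\<tau> \<in> \<T>" "z \<in> \<tau>" "\<And>x. x \<notin> \<tau> \<Longrightarrow> \<delta> x = 0"
    "\<And>v. v \<in> P1_space \<T> \<Longrightarrow> (LINT x|lebesgue_on \<tau>. \<delta> x * v x) = v z"
    "\<delta> \<in> Lp 2 (interior \<tau>)" "(LINT x|lebesgue_on (interior \<tau>). (\<delta> x)\<^sup>2) \<le> K\<^sup>2 / h ^ 3"
proof -
  obtain \<tau> where \<tau>: "\<tau> \<in> \<T>" "z \<in> \<tau>" "\<And>x. x \<notin> \<tau> \<Longrightarrow> \<delta> x = 0"
    "\<And>v. v \<in> P1_space \<T> \<Longrightarrow> (LINT x|lebesgue_on \<tau>. \<delta> x * v x) = v z"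
    and all: "\<And>p::ereal. 1 \<le> p \<Longrightarrow> \<delta> \<in> W1 p (interior \<tau>) \<and>
           Lp_norm p (interior \<tau>) \<delta> \<le> K * h powr (- 3 * (1 - real_of_ereal (1 / p)))"
    using assms(1) unfolding regularized_delta_def by blast
  have "\<delta> \<in> W1 2 (interior \<tau>)" and n: "Lp_norm 2 (interior \<tau>) \<delta> \<le> K * h powr (- 3 * (1 - real_of_ereal (1 / 2)))"
    using all[of 2] by simp_all
  then have L: "\<delta> \<in> Lp 2 (interior \<tau>)" by (simp add: W1_def)
  have half: "real_of_ereal (1 / 2) = 1 / 2" by (simp add: one_ereal_def)
  have "- 3 * (1 - real_of_ereal (1 / 2)) = - 3 / 2" unfolding half by simp
  then have "Lp_norm 2 (interior \<tau>) \<delta> \<le> K * h powr (- 3 / 2)" using n by (simp only:)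
  then have n: "sqrt (LINT x|lebesgue_on (interior \<tau>). (\<delta> x)\<^sup>2) \<le> K * h powr (- 3 / 2)"
    by (simp add: Lp_norm_2)
  have "(sqrt (LINT x|lebesgue_on (interior \<tau>). (\<delta> x)\<^sup>2))\<^sup>2 \<le> (K * h powr (- 3 / 2))\<^sup>2"
    using n by (rule power_mono) simp
  moreover have "(h powr (- 3 / 2))\<^sup>2 = 1 / h ^ 3"
    using h by (simp add: power2_eq_square powr_add[symmetric] powr_minus_divide powr_numeral)
  ultimately have "(LINT x|lebesgue_on (interior \<tau>). (\<delta> x)\<^sup>2) \<le> K\<^sup>2 / h ^ 3"
    by (simp add: power_mult_distrib)
  then show ?thesis using \<tau> L that by blast
qed

lemma integral_lebesgue_on_AE_zero_outside:
  fixes f :: "'a::euclidean_space \<Rightarrow> real"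
  assumes A: "A \<in> sets lebesgue" and S: "S \<in> sets lebesgue" "A \<subseteq> S"
    and f: "f \<in> borel_measurable (lebesgue_on A)"
    and z: "AE x in lebesgue. x \<in> S \<longrightarrow> x \<notin> A \<longrightarrow> f x = 0"
  shows "(LINT x|lebesgue_on S. f x) = (LINT x|lebesgue_on A. f x)"
proof -
  have m: "(\<lambda>x. if x \<in> A then f x else 0) \<in> borel_measurable lebesgue"
    using f A by (simp add: borel_measurable_if)
  have ae: "AE x in lebesgue. (if x \<in> A then f x else 0) = (if x \<in> S then f x else 0)"
    using z by eventually_elim (use S(2) in auto)
  have "(LINT x|lebesgue. (if x \<in> A then f x else 0)) = (LINT x|lebesgue. (if x \<in> S then f x else 0))"
    by (rule integral_cong_AE[OF m borel_measurable_AE[OF m ae] ae])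
  then show ?thesis
    using Lebesgue_Measure.integral_restrict_UNIV[OF A, of f] Lebesgue_Measure.integral_restrict_UNIV[OF S(1), of f] by simp
qed

text \<open>
  The boundary of a tetrahedron is a null set, so the integral of \<open>\<delta> v\<close> is the same over the
  closed element, over \<open>\<Omega>\<close> and over the interior of the element. The interior is the set on which
  the integrability of \<open>\<delta>\<close> is known.
\<close>

lemma integral_delta:
  fixes \<tau> :: "(real^3) set" and \<delta> v :: "real^3 \<Rightarrow> real"
  assumes \<tau>: "3 simplex \<tau>" "interior \<tau> \<subseteq> S" and S: "S \<in> sets lebesgue"
    and z: "\<And>x. x \<notin> \<tau> \<Longrightarrow> \<delta> x = 0"
    and m: "\<delta> \<in> borel_measurable (lebesgue_on (interior \<tau>))" "v \<in> borel_measurable (lebesgue_on (interior \<tau>))"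
  shows "(LINT x|lebesgue_on S. \<delta> x * v x) = (LINT x|lebesgue_on (interior \<tau>). \<delta> x * v x)"
proof (rule integral_lebesgue_on_AE_zero_outside)
  have "AE x in lebesgue. x \<notin> frontier \<tau>"
    using simplex_negligible_frontier[OF \<tau>(1)] unfolding negligible_iff_null_sets by (rule AE_not_in)
  then show "AE x in lebesgue. x \<in> S \<longrightarrow> x \<notin> interior \<tau> \<longrightarrow> \<delta> x * v x = 0"
    by eventually_elim (use z closure_closed[OF closed_simplex[OF \<tau>(1)]] in \<open>auto simp: frontier_def\<close>)
qed (use \<tau> S m in \<open>auto simp: lborelD\<close>)

lemma Lp_2_inner_integrable:
  fixes p q :: "real^3 \<Rightarrow> 'b::euclidean_space"
  assumes p: "p \<in> Lp 2 U" and q: "q \<in> Lp 2 U"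
  shows "integrable (lebesgue_on U) (\<lambda>x. p x \<bullet> q x)"
proof (rule Bochner_Integration.integrable_bound)
  show "integrable (lebesgue_on U) (\<lambda>x. (norm (p x))\<^sup>2 + (norm (q x))\<^sup>2)"
    using p q by (simp add: Lp_2_iff)
  have "p \<in> borel_measurable (lebesgue_on U)" "q \<in> borel_measurable (lebesgue_on U)"
    using p q by (simp_all add: Lp_2_iff)
  then show "(\<lambda>x. p x \<bullet> q x) \<in> borel_measurable (lebesgue_on U)" by measurable
  show "AE x in lebesgue_on U. norm (p x \<bullet> q x) \<le> norm ((norm (p x))\<^sup>2 + (norm (q x))\<^sup>2)"
  proof (rule AE_I2)
    fix x
    have "0 \<le> norm (p x) * norm (q x)" by simp
    then show "norm (p x \<bullet> q x) \<le> norm ((norm (p x))\<^sup>2 + (norm (q x))\<^sup>2)"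
      using Cauchy_Schwarz_ineq2[of "p x" "q x"] sum_squares_bound[of "norm (p x)" "norm (q x)"]
      by simp
  qed
qed

lemma Lp_2_subset:
  fixes p :: "real^3 \<Rightarrow> 'b::euclidean_space"
  assumes "p \<in> Lp 2 U" "U \<in> sets lebesgue" "S \<in> sets lebesgue" "S \<subseteq> U"
  shows "p \<in> Lp 2 S" "(LINT x|lebesgue_on S. (norm (p x))\<^sup>2) \<le> (LINT x|lebesgue_on U. (norm (p x))\<^sup>2)"
proof -
  have pm: "p \<in> borel_measurable (lebesgue_on U)" and i: "integrable (lebesgue_on U) (\<lambda>x. (norm (p x))\<^sup>2)"
    using assms(1) by (auto simp: Lp_2_iff)
  note m = integral_lebesgue_on_mono_set[OF assms(3,2,4) i]
  show "p \<in> Lp 2 S" using measurable_restrict_mono[OF pm assms(4)] m(1) by (simp add: Lp_2_iff)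
  show "(LINT x|lebesgue_on S. (norm (p x))\<^sup>2) \<le> (LINT x|lebesgue_on U. (norm (p x))\<^sup>2)"
    by (rule m(2)) simp
qed

text \<open>
  With \<open>p\<close> and \<open>q\<close> the gradients of \<open>v\<close> and \<open>u\<close>, the identity
  \<open>\<integral>\<^sub>M p\<^sup>2 = \<integral>\<^sub>M q p\<close> and \<open>q p \<le> q\<^sup>2 / 2 + p\<^sup>2 / 2\<close> give the claim after
  absorbing half of the left-hand side.
\<close>

lemma galerkin_gradient_bound:
  assumes \<Omega>: "open \<Omega>" and M: "open M" "M \<subseteq> \<Omega>"
    and u: "u \<in> H10 \<Omega>" and v: "v \<in> H10 \<Omega>"
    and v0: "AE x in lebesgue_on \<Omega>. x \<notin> M \<longrightarrow> weak_gradient \<Omega> v x = 0"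
    and orth: "grad_form \<Omega> u v = grad_form \<Omega> v v"
  shows "Lp_norm 2 M (weak_gradient \<Omega> v) \<le> Lp_norm 2 M (weak_gradient \<Omega> u)"
proof -
  let ?p = "weak_gradient \<Omega> v" and ?q = "weak_gradient \<Omega> u"
  have ms: "\<Omega> \<in> sets lebesgue" "M \<in> sets lebesgue" using \<Omega> M by (simp_all add: lborelD)
  have p: "?p \<in> Lp 2 M" and q: "?q \<in> Lp 2 M"
    using Lp_2_subset(1)[OF _ ms M(2)] H10D(3)[OF \<Omega>] u v by auto
  have v0': "AE x in lebesgue. x \<in> \<Omega> \<longrightarrow> x \<notin> M \<longrightarrow> ?p x = 0"
    using v0 ms by (simp add: AE_restrict_space_iff)
  have cut: "grad_form \<Omega> w v = (LINT x|lebesgue_on M. weak_gradient \<Omega> w x \<bullet> ?p x)" if "weak_gradient \<Omega> w \<in> Lp 2 M" for w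
    unfolding grad_form_def
  proof (rule integral_lebesgue_on_AE_zero_outside[OF ms(2,1) M(2)])
    show "(\<lambda>x. weak_gradient \<Omega> w x \<bullet> ?p x) \<in> borel_measurable (lebesgue_on M)"
      using Lp_2_inner_integrable[OF that p] by simp
    show "AE x in lebesgue. x \<in> \<Omega> \<longrightarrow> x \<notin> M \<longrightarrow> weak_gradient \<Omega> w x \<bullet> ?p x = 0"
      using v0' by eventually_elim simp
  qed
  have ip: "integrable (lebesgue_on M) (\<lambda>x. (norm (?p x))\<^sup>2)" and iq: "integrable (lebesgue_on M) (\<lambda>x. (norm (?q x))\<^sup>2)"
    using p q by (simp_all add: Lp_2_iff)
  have "(LINT x|lebesgue_on M. ?q x \<bullet> ?p x) \<le> (LINT x|lebesgue_on M. (norm (?q x))\<^sup>2 / 2 + (norm (?p x))\<^sup>2 / 2)"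
  proof (rule integral_mono)
    show "?q x \<bullet> ?p x \<le> (norm (?q x))\<^sup>2 / 2 + (norm (?p x))\<^sup>2 / 2" for x
      using Cauchy_Schwarz_ineq2[of "?q x" "?p x"] sum_squares_bound[of "norm (?q x)" "norm (?p x)"] by linarith
  qed (use Lp_2_inner_integrable[OF q p] ip iq in auto)
  also have "\<dots> = (LINT x|lebesgue_on M. (norm (?q x))\<^sup>2) / 2 + (LINT x|lebesgue_on M. (norm (?p x))\<^sup>2) / 2"
    using ip iq by simp
  finally have "(LINT x|lebesgue_on M. (norm (?p x))\<^sup>2) \<le> (LINT x|lebesgue_on M. (norm (?q x))\<^sup>2)"
    using orth cut[OF p] cut[OF q] by (simp add: power2_norm_eq_inner)
  then show ?thesis by (simp add: Lp_norm_2)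
qed

text \<open>
  Test the equation with its solution. The weights in Young's inequality are chosen such that the local
  Poincare inequality turns the term in \<open>u\<close> into exactly half of the energy.
\<close>

lemma energy_bound_localized_source:
  assumes \<Omega>: "open \<Omega>" and u: "dirichlet_solution \<Omega> \<delta> u" and h: "0 < h"
    and \<tau>: "3 simplex \<tau>" "interior \<tau> \<subseteq> \<Omega>" "interior \<tau> \<subseteq> cball z h"
    and \<delta>: "\<And>x. x \<notin> \<tau> \<Longrightarrow> \<delta> x = 0" "\<delta> \<in> Lp 2 (interior \<tau>)"
  shows "(LINT x|lebesgue_on \<Omega>. (norm (weak_gradient \<Omega> u x))\<^sup>2) \<le> 32 * h\<^sup>2 * (LINT x|lebesgue_on (interior \<tau>). (\<delta> x)\<^sup>2)"
proof -
  let ?S = "interior \<tau>"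
  let ?E = "LINT x|lebesgue_on \<Omega>. (norm (weak_gradient \<Omega> u x))\<^sup>2"
  have ms: "\<Omega> \<in> sets lebesgue" "?S \<in> sets lebesgue" using \<Omega> by (simp_all add: lborelD)
  have uH: "u \<in> H10 \<Omega>" and eq: "grad_form \<Omega> u u = (LINT x|lebesgue_on \<Omega>. \<delta> x * u x)"
    using u by (auto simp: dirichlet_solution_def)
  have uL: "u \<in> Lp 2 ?S" using Lp_2_subset(1)[OF H10D(1)[OF \<Omega> uH] ms \<tau>(2)] .
  have iu: "integrable (lebesgue_on ?S) (\<lambda>x. (u x)\<^sup>2)" and id: "integrable (lebesgue_on ?S) (\<lambda>x. (\<delta> x)\<^sup>2)"
    using uL \<delta>(2) by (simp_all add: Lp_2_iff)
  have iud: "integrable (lebesgue_on ?S) (\<lambda>x. \<delta> x * u x)"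
    using Lp_2_inner_integrable[OF \<delta>(2) uL] by simp
  have "?E = (LINT x|lebesgue_on \<Omega>. \<delta> x * u x)"
    using eq by (simp add: grad_form_def power2_norm_eq_inner)
  also have "\<dots> = (LINT x|lebesgue_on ?S. \<delta> x * u x)"
    by (rule integral_delta[OF \<tau>(1,2) ms(1) \<delta>(1)]) (use uL \<delta>(2) in \<open>auto simp: Lp_2_iff\<close>)
  also have "\<dots> \<le> (LINT x|lebesgue_on ?S. 16 * h\<^sup>2 * (\<delta> x)\<^sup>2 + (1 / (64 * h\<^sup>2)) * (u x)\<^sup>2)"
  proof (rule integral_mono[OF iud])
    show "integrable (lebesgue_on ?S) (\<lambda>x. 16 * h\<^sup>2 * (\<delta> x)\<^sup>2 + (1 / (64 * h\<^sup>2)) * (u x)\<^sup>2)"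
      by (intro Bochner_Integration.integrable_add integrable_mult_right iu id)
    show "\<delta> x * u x \<le> 16 * h\<^sup>2 * (\<delta> x)\<^sup>2 + (1 / (64 * h\<^sup>2)) * (u x)\<^sup>2" for x
      using sum_squares_bound[of "4 * h * \<delta> x" "u x / (8 * h)"] h
      by (simp add: power_mult_distrib power_divide)
  qed
  also have "\<dots> = 16 * h\<^sup>2 * (LINT x|lebesgue_on ?S. (\<delta> x)\<^sup>2) + (1 / (64 * h\<^sup>2)) * (LINT x|lebesgue_on ?S. (u x)\<^sup>2)"
    by (subst Bochner_Integration.integral_add) (auto intro!: integrable_mult_right iu id)
  also have "\<dots> \<le> 16 * h\<^sup>2 * (LINT x|lebesgue_on ?S. (\<delta> x)\<^sup>2) + (1 / (64 * h\<^sup>2)) * (32 * h\<^sup>2 * ?E)"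
    by (intro add_left_mono mult_left_mono local_poincare_H10[OF \<Omega> uH h ms(2) \<tau>(3,2)]) simp
  also have "(1 / (64 * h\<^sup>2)) * (32 * h\<^sup>2 * ?E) = ?E / 2" using h by simp
  finally show ?thesis by simp
qed

theorem corollary4p2:
  fixes \<Omega> :: "(real^3) set"
    and \<T> :: "real \<Rightarrow> (real^3) set set"
    and K :: real
    and \<delta> :: "real \<Rightarrow> real^3 \<Rightarrow> real^3 \<Rightarrow> real"
    and Gh :: "real \<Rightarrow> real^3 \<Rightarrow> real^3 \<Rightarrow> real"
    and Gt :: "real \<Rightarrow> real^3 \<Rightarrow> real^3 \<Rightarrow> real"
  assumes "open \<Omega>" and "\<Omega> \<noteq> {}" and "convex \<Omega>" and "bounded \<Omega>"
    and "Ck_boundary 2 \<Omega>"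
    and "mesh_family \<Omega> \<T>" and "quasi_uniform \<T>" and "shape_regular \<T>"
    and "\<And>h z. \<lbrakk>0 < h; h < 1; z \<in> mesh_domain (\<T> h)\<rbrakk> \<Longrightarrow> regularized_delta (\<T> h) h K z (\<delta> h z)"
    and "\<And>h z. \<lbrakk>0 < h; h < 1; z \<in> mesh_domain (\<T> h)\<rbrakk> \<Longrightarrow> discrete_green \<Omega> (\<T> h) z (Gh h z)"
    and "\<And>h z. \<lbrakk>0 < h; h < 1; z \<in> mesh_domain (\<T> h)\<rbrakk> \<Longrightarrow> dirichlet_solution \<Omega> (\<delta> h z) (Gt h z)"
  shows "\<exists>C. \<forall>h z. 0 < h \<and> h < 1 \<and> z \<in> mesh_domain (\<T> h) \<longrightarrow>
           Lp_norm 2 (mesh_domain (\<T> h)) (weak_gradient \<Omega> (Gh h z))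
             \<le> Lp_norm 2 (mesh_domain (\<T> h)) (weak_gradient \<Omega> (Gt h z)) \<and>
           Lp_norm 2 (mesh_domain (\<T> h)) (weak_gradient \<Omega> (Gt h z)) \<le> C * h powr (-1/2)"
proof (intro exI[of _ "sqrt (32 * K\<^sup>2)"] allI impI)
  \<comment> \<open>The energy of \<open>Gt\<close> is at most \<open>32 h\<^sup>2\<close> times the bound \<open>K\<^sup>2 / h\<^sup>3\<close> of the squared norm of \<open>\<delta>\<close>, hence the constant.\<close>
  fix h z assume hz: "0 < h \<and> h < 1 \<and> z \<in> mesh_domain (\<T> h)"
  then have h: "0 < h" "h < 1" and z: "z \<in> mesh_domain (\<T> h)" by auto
  let ?M = "mesh_domain (\<T> h)"
  have T: "tetrahedral_mesh (\<T> h)" and M\<Omega>: "?M \<subseteq> \<Omega>" and diam: "\<And>\<tau>. \<tau> \<in> \<T> h \<Longrightarrow> diameter \<tau> \<le> h"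
    using assms(6) h by (auto simp: mesh_family_def)
  have Mo: "open ?M" by (simp add: mesh_domain_def)
  have ms: "\<Omega> \<in> sets lebesgue" "?M \<in> sets lebesgue" using assms(1) Mo by (simp_all add: lborelD)
  obtain \<tau> where \<tau>: "\<tau> \<in> \<T> h" "z \<in> \<tau>" and \<delta>0: "\<And>x. x \<notin> \<tau> \<Longrightarrow> \<delta> h z x = 0"
    and rep: "\<And>v. v \<in> P1_space (\<T> h) \<Longrightarrow> (LINT x|lebesgue_on \<tau>. \<delta> h z x * v x) = v z"
    and \<delta>L: "\<delta> h z \<in> Lp 2 (interior \<tau>)" and \<delta>n: "(LINT x|lebesgue_on (interior \<tau>). (\<delta> h z x)\<^sup>2) \<le> K\<^sup>2 / h ^ 3"
    using regularized_delta_L2[OF assms(9)[OF h z] h(1)] by blast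
  have s: "3 simplex \<tau>" using T \<tau>(1) by (simp add: tetrahedral_mesh_def)
  have \<tau>c: "compact \<tau>" by (rule compact_simplex[OF s])
  have iM: "interior \<tau> \<subseteq> ?M" by (rule interior_subset_mesh_domain[OF \<tau>(1)])
  have i\<Omega>: "interior \<tau> \<subseteq> \<Omega>" using iM M\<Omega> by auto
  have ball: "interior \<tau> \<subseteq> cball z h"
  proof
    fix x assume "x \<in> interior \<tau>"
    then have "dist z x \<le> diameter \<tau>"
      using \<tau>(2) interior_subset by (intro diameter_bounded_bound compact_imp_bounded[OF \<tau>c]) auto
    then show "x \<in> cball z h" using diam[OF \<tau>(1)] by simp
  qed
  have sol: "dirichlet_solution \<Omega> (\<delta> h z) (Gt h z)" by (rule assms(11)[OF h z])
  have gt: "Gt h z \<in> H10 \<Omega>" using sol by (simp add: dirichlet_solution_def)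
  have gh: "Gh h z \<in> P1_space0 (\<T> h)" and ghz: "grad_form \<Omega> (Gh h z) (Gh h z) = Gh h z z"
    using assms(10)[OF h z] by (auto simp: discrete_green_def)
  note H = P1_space0_H10[OF assms(1,3,4,2) T M\<Omega> gh]
  have ghL: "Gh h z \<in> Lp 2 (interior \<tau>)"
    by (rule Lp_2_subset(1)[OF H10D(1)[OF assms(1) H(1)] ms(1) _ i\<Omega>]) (simp add: lborelD)
  have mm: "\<delta> h z \<in> borel_measurable (lebesgue_on (interior \<tau>))" "Gh h z \<in> borel_measurable (lebesgue_on (interior \<tau>))"
    using \<delta>L ghL by (simp_all add: Lp_2_iff)
  have "grad_form \<Omega> (Gt h z) (Gh h z) = (LINT x|lebesgue_on \<Omega>. \<delta> h z x * Gh h z x)"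
    using sol H(1) by (simp add: dirichlet_solution_def)
  also have "\<dots> = (LINT x|lebesgue_on \<tau>. \<delta> h z x * Gh h z x)"
    using integral_delta[OF s i\<Omega> ms(1) \<delta>0 mm] integral_delta[OF s interior_subset _ \<delta>0 mm]
      fmeasurableD[OF lmeasurable_compact[OF \<tau>c]] by simp
  also have "\<dots> = Gh h z z" using gh by (intro rep) (simp add: P1_space0_def)
  finally have orth: "grad_form \<Omega> (Gt h z) (Gh h z) = grad_form \<Omega> (Gh h z) (Gh h z)" using ghz by simp
  have 1: "Lp_norm 2 ?M (weak_gradient \<Omega> (Gh h z)) \<le> Lp_norm 2 ?M (weak_gradient \<Omega> (Gt h z))"
    by (rule galerkin_gradient_bound[OF assms(1) Mo M\<Omega> gt H orth])
  have "(LINT x|lebesgue_on ?M. (norm (weak_gradient \<Omega> (Gt h z) x))\<^sup>2)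
      \<le> (LINT x|lebesgue_on \<Omega>. (norm (weak_gradient \<Omega> (Gt h z) x))\<^sup>2)"
    by (rule Lp_2_subset(2)[OF H10D(3)[OF assms(1) gt] ms M\<Omega>])
  also have "\<dots> \<le> 32 * h\<^sup>2 * (LINT x|lebesgue_on (interior \<tau>). (\<delta> h z x)\<^sup>2)"
    by (rule energy_bound_localized_source[OF assms(1) sol h(1) s i\<Omega> ball \<delta>0 \<delta>L])
  also have "\<dots> \<le> 32 * h\<^sup>2 * (K\<^sup>2 / h ^ 3)" using \<delta>n by (intro mult_left_mono) auto
  also have "\<dots> = 32 * K\<^sup>2 / h" using h(1) by (simp add: power2_eq_square power3_eq_cube)
  finally have "Lp_norm 2 ?M (weak_gradient \<Omega> (Gt h z)) \<le> sqrt (32 * K\<^sup>2 / h)"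
    by (simp add: Lp_norm_2)
  also have "\<dots> = sqrt (32 * K\<^sup>2) * h powr (-1/2)"
    using h(1) by (simp add: real_sqrt_divide powr_minus_divide powr_half_sqrt[symmetric])
  finally have 2: "Lp_norm 2 ?M (weak_gradient \<Omega> (Gt h z)) \<le> sqrt (32 * K\<^sup>2) * h powr (-1/2)" .
  show "Lp_norm 2 ?M (weak_gradient \<Omega> (Gh h z)) \<le> Lp_norm 2 ?M (weak_gradient \<Omega> (Gt h z)) \<and>
      Lp_norm 2 ?M (weak_gradient \<Omega> (Gt h z)) \<le> sqrt (32 * K\<^sup>2) * h powr (-1/2)"
    using 1 2 by simp
qed

end
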